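(* Let $n \in \mathbb{N}_0$ and $\epsilon \in \{1,-1\}$. The $U_q$-module $T(n,\epsilon)$ is generated by (the image in $T(n,\epsilon)$ of) $$z = \sum_{i=0}^{n} \epsilon^{n-i}\, \frac{[n]!\,[n-i]!}{[i]!}\, f^i e^i .$$ Set $v_{-1}=0$, $z_n=0$ and, for $i \ge 0$, let $v_i = f^i e^{n+1}$ and $z_{n+1+i} = f^i z$ (images in $T(n,\epsilon)$). Then $\{v_i,\ z_{n+1+i} \mid i \ge 0\}$ is a $k$-basis of $T(n,\epsilon)$. Moreover, for all $i \ge n+1$, \begin{align*} t z_i &= \epsilon q^{n-2i} z_i,\\ f z_i &= z_{i+1},\\ e z_i &= \epsilon [i][n-i+1] z_{i-1} + v_{i-1}, \end{align*} and $\{v_i \mid i \ge 0\}$ is a $k$-basis of the Verma submodule of $T(n,\epsilon)$ with highest weight $\epsilon q^n$ and the usual $U_q$-action, that is, for all $i\ge 0$, $t v_i = \epsilon q^{n-2i} v_i$, $f v_i = v_{i+1}$, $e v_i = \epsilon [i][n-i+1] v_{i-1}$.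
   Context: Let $k$ be a field with $\operatorname{char} k \neq 2,3$ and let $q \in k$, $q\neq 0$, be not a root of unity. $\mathbb{N}_0=\{0,1,2,\dots\}$. $U_q=U_q(sl_2)$ is the associative unital $k$-algebra with generators $e,f,t,t^{-1}$ and relations $tt^{-1}=1=t^{-1}t$, $tet^{-1}=q^2e$, $tft^{-1}=q^{-2}f$, $ef-fe=\frac{t-t^{-1}}{q-q^{-1}}$. For $m\in\mathbb{Z}$ put $[m]=\frac{q^m-q^{-m}}{q-q^{-1}}$, and $[m]!=[1][2]\cdots[m]$ for $m\ge 1$, $[0]!=1$. The quantum Casimir element is the central element $C=\frac{qt+q^{-1}t^{-1}}{(q-q^{-1})^2}+fe$ of $U_q$. For $n\in\mathbb{N}_0$ and $\epsilon=\pm1$ let $c=\frac{q^{n+1}+q^{-n-1}}{(q-q^{-1})^2}$, let $I(n,\epsilon)=U_q\{t-\epsilon q^{-n-2},\, e^{n+2},\,(C-\epsilon c)^2\}$ be the left ideal of $U_q$ generated by the listed elements, and let $T(n,\epsilon)=U_q/I(n,\epsilon)$, a left $U_q$-module (a "$T$ module"). An element of $U_q$ also denotes its image in $T(n,\epsilon)$. For $\lambda\in k^\times=k\smallsetminus\{0\}$, $M(\lambda)$ is the Verma module of highest weight $\lambda$: the $U_q$-module with $k$-basis $\{v_i\}_{i\ge0}$ and action $tv_i=q^{-2i}\lambda v_i$, $fv_i=v_{i+1}$, $ev_i=[i]\frac{q^{1-i}\lambda-q^{i-1}\lambda^{-1}}{q-q^{-1}}v_{i-1}$ (with $v_{-1}=0$).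 *)

theory Defs
  imports
    "HOL-Algebra.QuotRing"
    "HOL-Library.Poly_Mapping"
    "Jordan_Normal_Form.VS_Connect"
begin

section \<open>Left modules and left ideals over a noncommutative ring\<close>

text \<open>The locale \<open>module\<close> of HOL-Algebra assumes a commutative ring of scalars; the record type
  \<open>module\<close> and the locale \<open>Module.submodule\<close> do not, and are reused here. The ring fields
  \<open>mult\<close> and \<open>one\<close> of a module record are irrelevant.\<close>

locale left_module = R?: ring R + M?: abelian_group M
  for R :: "('a, 'c) ring_scheme" (structure) and M :: "('a, 'b, 'd) module_scheme" (structure) +
  assumes smult_closed:
      "\<lbrakk>a \<in> carrier R; x \<in> carrier M\<rbrakk> \<Longrightarrow> a \<odot>\<^bsub>M\<^esub> x \<in> carrier M"
    and smult_l_distr: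
      "\<lbrakk>a \<in> carrier R; b \<in> carrier R; x \<in> carrier M\<rbrakk> \<Longrightarrow>
       (a \<oplus>\<^bsub>R\<^esub> b) \<odot>\<^bsub>M\<^esub> x = a \<odot>\<^bsub>M\<^esub> x \<oplus>\<^bsub>M\<^esub> b \<odot>\<^bsub>M\<^esub> x"
    and smult_r_distr:
      "\<lbrakk>a \<in> carrier R; x \<in> carrier M; y \<in> carrier M\<rbrakk> \<Longrightarrow>
       a \<odot>\<^bsub>M\<^esub> (x \<oplus>\<^bsub>M\<^esub> y) = a \<odot>\<^bsub>M\<^esub> x \<oplus>\<^bsub>M\<^esub> a \<odot>\<^bsub>M\<^esub> y"
    and smult_assoc1:
      "\<lbrakk>a \<in> carrier R; b \<in> carrier R; x \<in> carrier M\<rbrakk> \<Longrightarrow>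
       (a \<otimes>\<^bsub>R\<^esub> b) \<odot>\<^bsub>M\<^esub> x = a \<odot>\<^bsub>M\<^esub> (b \<odot>\<^bsub>M\<^esub> x)"
    and smult_one:
      "x \<in> carrier M \<Longrightarrow> \<one>\<^bsub>R\<^esub> \<odot>\<^bsub>M\<^esub> x = x"

definition gen_submodule ::
  "('a, 'c) ring_scheme \<Rightarrow> ('a, 'b, 'd) module_scheme \<Rightarrow> 'b set \<Rightarrow> 'b set" where
  "gen_submodule R M S = \<Inter>{N. Module.submodule N R M \<and> S \<subseteq> N}"

locale left_ideal = additive_subgroup I R + ring R
  for I and R (structure) +
  assumes I_l_closed: "\<lbrakk>a \<in> I; x \<in> carrier R\<rbrakk> \<Longrightarrow> x \<otimes>\<^bsub>R\<^esub> a \<in> I"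

definition gen_left_ideal :: "('a, 'c) ring_scheme \<Rightarrow> 'a set \<Rightarrow> 'a set" where
  "gen_left_ideal R S = \<Inter>{I. left_ideal I R \<and> S \<subseteq> I}"

text \<open>The left module \<open>R/I\<close>, on the same cosets as \<open>FactRing\<close>; the action is
  \<open>a (I + x) = I + a x\<close> (lemma \<open>left_quot_smult\<close>).\<close>

definition left_quot :: "('a, 'c) ring_scheme \<Rightarrow> 'a set \<Rightarrow> ('a, 'a set) module" where
  "left_quot R I =
    \<lparr>carrier = a_rcosets\<^bsub>R\<^esub> I, mult = undefined, one = undefined,
     zero = I, add = set_add R,
     smult = (\<lambda>a X. \<Union>x\<in>X. I +>\<^bsub>R\<^esub> (a \<otimes>\<^bsub>R\<^esub> x))\<rparr>"

lemma left_ideal_gen_left_ideal: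
  assumes "ring R" "S \<subseteq> carrier R"
  shows "left_ideal (gen_left_ideal R S) R"
proof -
  interpret ring R by fact
  have car: "left_ideal (carrier R) R"
    by (intro left_ideal.intro left_ideal_axioms.intro additive_subgroup.intro
        add.subgroup_self ring_axioms) auto
  have mem: "x \<in> gen_left_ideal R S \<longleftrightarrow> (\<forall>I. left_ideal I R \<longrightarrow> S \<subseteq> I \<longrightarrow> x \<in> I)" for x
    by (auto simp: gen_left_ideal_def)
  note sub = left_ideal.axioms(1)
  show ?thesis
  proof (intro left_ideal.intro left_ideal_axioms.intro additive_subgroup.intro ring_axioms)
    show "subgroup (gen_left_ideal R S) (add_monoid R)"
    proof (rule add.subgroupI)
      show "gen_left_ideal R S \<subseteq> carrier R"
        using car assms(2) by (auto simp: mem)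
      have "\<zero>\<^bsub>R\<^esub> \<in> gen_left_ideal R S"
        by (simp add: mem additive_subgroup.zero_closed[OF sub])
      then show "gen_left_ideal R S \<noteq> {}" by blast
      show "\<ominus>\<^bsub>R\<^esub> a \<in> gen_left_ideal R S" if "a \<in> gen_left_ideal R S" for a
        using that by (simp add: mem additive_subgroup.a_inv_closed[OF sub])
      show "a \<oplus>\<^bsub>R\<^esub> b \<in> gen_left_ideal R S"
        if "a \<in> gen_left_ideal R S" "b \<in> gen_left_ideal R S" for a b
        using that by (simp add: mem additive_subgroup.a_closed[OF sub])
    qed
    show "x \<otimes>\<^bsub>R\<^esub> a \<in> gen_left_ideal R S"
      if "a \<in> gen_left_ideal R S" "x \<in> carrier R" for a x
      using that by (simp add: mem left_ideal.I_l_closed)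
  qed
qed

lemma left_quot_smult:
  assumes "left_ideal I R" "a \<in> carrier R" "x \<in> carrier R"
  shows "a \<odot>\<^bsub>left_quot R I\<^esub> (I +>\<^bsub>R\<^esub> x) = I +>\<^bsub>R\<^esub> (a \<otimes>\<^bsub>R\<^esub> x)"
proof -
  interpret left_ideal I R by fact
  interpret abelian_subgroup I R
    by (intro abelian_subgroupI3 additive_subgroup_axioms abelian_group_axioms)
  have *: "I +>\<^bsub>R\<^esub> (a \<otimes>\<^bsub>R\<^esub> y) = I +>\<^bsub>R\<^esub> (a \<otimes>\<^bsub>R\<^esub> x)" if y: "y \<in> I +>\<^bsub>R\<^esub> x" for y
  proof -
    obtain h where h: "h \<in> I" "y = h \<oplus>\<^bsub>R\<^esub> x"
      using y unfolding a_r_coset_def' by blast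
    have hc: "h \<in> carrier R" using h a_subset by blast
    have "a \<otimes>\<^bsub>R\<^esub> y = a \<otimes>\<^bsub>R\<^esub> h \<oplus>\<^bsub>R\<^esub> a \<otimes>\<^bsub>R\<^esub> x"
      using h hc assms by (simp add: r_distr)
    hence "a \<otimes>\<^bsub>R\<^esub> y \<in> I +>\<^bsub>R\<^esub> (a \<otimes>\<^bsub>R\<^esub> x)"
      using I_l_closed[OF h(1) assms(2)] unfolding a_r_coset_def' by blast
    thus ?thesis
      by (intro a_repr_independence[OF _ _ a_subgroup, symmetric] m_closed assms)
  qed
  have "x \<in> I +>\<^bsub>R\<^esub> x" using a_rcos_self assms by blast
  then have "I +>\<^bsub>R\<^esub> x \<noteq> {}" by blast
  then have "(\<Union>y\<in>I +>\<^bsub>R\<^esub> x. I +>\<^bsub>R\<^esub> (a \<otimes>\<^bsub>R\<^esub> y)) = I +>\<^bsub>R\<^esub> (a \<otimes>\<^bsub>R\<^esub> x)"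
    by (rule SUP_eq_const) (rule *)
  then show ?thesis by (simp add: left_quot_def)
qed

lemma left_module_left_quot:
  assumes "left_ideal I R"
  shows "left_module R (left_quot R I)"
proof -
  interpret left_ideal I R by fact
  interpret abelian_subgroup I R
    by (intro abelian_subgroupI3 additive_subgroup_axioms abelian_group_axioms)
  have car: "\<exists>y\<in>carrier R. x = I +>\<^bsub>R\<^esub> y" if "x \<in> carrier (left_quot R I)" for x
    using that by (auto simp: left_quot_def A_RCOSETS_def')
  have in_car: "I +>\<^bsub>R\<^esub> y \<in> carrier (left_quot R I)" if "y \<in> carrier R" for y
    using that by (auto simp: left_quot_def A_RCOSETS_def')
  have add: "(I +>\<^bsub>R\<^esub> x) \<oplus>\<^bsub>left_quot R I\<^esub> (I +>\<^bsub>R\<^esub> y) = I +>\<^bsub>R\<^esub> (x \<oplus>\<^bsub>R\<^esub> y)"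
    if "x \<in> carrier R" "y \<in> carrier R" for x y
    using a_rcos_sum[OF that] by (simp add: left_quot_def)
  have zero: "\<zero>\<^bsub>left_quot R I\<^esub> = I +>\<^bsub>R\<^esub> \<zero>\<^bsub>R\<^esub>"
    using a_coset_add_zero[OF a_subset] by (simp add: left_quot_def)
  have grp: "abelian_group (left_quot R I)"
  proof (rule abelian_groupI)
    fix x assume x: "x \<in> carrier (left_quot R I)"
    then obtain y where y: "y \<in> carrier R" "x = I +>\<^bsub>R\<^esub> y" using car by blast
    then have "(I +>\<^bsub>R\<^esub> (\<ominus>\<^bsub>R\<^esub> y)) \<oplus>\<^bsub>left_quot R I\<^esub> x = \<zero>\<^bsub>left_quot R I\<^esub>"
      by (simp add: add zero l_neg)
    then show "\<exists>y\<in>carrier (left_quot R I). y \<oplus>\<^bsub>left_quot R I\<^esub> x = \<zero>\<^bsub>left_quot R I\<^esub>"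
      using in_car y by blast
  qed (auto dest!: car simp: add zero in_car a_ac)
  note sm = left_quot_smult[OF assms]
  show ?thesis
  proof (intro left_module.intro left_module_axioms.intro ring_axioms grp)
    fix a x assume "a \<in> carrier R" "x \<in> carrier (left_quot R I)"
    then show "a \<odot>\<^bsub>left_quot R I\<^esub> x \<in> carrier (left_quot R I)"
      using car[of x] by (auto simp: sm in_car)
  next
    fix a b x assume "a \<in> carrier R" "b \<in> carrier R" "x \<in> carrier (left_quot R I)"
    then show "(a \<oplus>\<^bsub>R\<^esub> b) \<odot>\<^bsub>left_quot R I\<^esub> x =
        a \<odot>\<^bsub>left_quot R I\<^esub> x \<oplus>\<^bsub>left_quot R I\<^esub> b \<odot>\<^bsub>left_quot R I\<^esub> x"
      using car[of x] by (auto simp: sm add l_distr)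
  next
    fix a x y
    assume "a \<in> carrier R" "x \<in> carrier (left_quot R I)" "y \<in> carrier (left_quot R I)"
    then show "a \<odot>\<^bsub>left_quot R I\<^esub> (x \<oplus>\<^bsub>left_quot R I\<^esub> y) =
        a \<odot>\<^bsub>left_quot R I\<^esub> x \<oplus>\<^bsub>left_quot R I\<^esub> a \<odot>\<^bsub>left_quot R I\<^esub> y"
      using car[of x] car[of y] by (auto simp: sm add r_distr)
  next
    fix a b x assume "a \<in> carrier R" "b \<in> carrier R" "x \<in> carrier (left_quot R I)"
    then show "(a \<otimes>\<^bsub>R\<^esub> b) \<odot>\<^bsub>left_quot R I\<^esub> x =
        a \<odot>\<^bsub>left_quot R I\<^esub> (b \<odot>\<^bsub>left_quot R I\<^esub> x)"
      using car[of x] by (auto simp: sm m_assoc)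
  next
    fix x assume "x \<in> carrier (left_quot R I)"
    then show "\<one>\<^bsub>R\<^esub> \<odot>\<^bsub>left_quot R I\<^esub> x = x"
      using car[of x] by (auto simp: sm)
  qed
qed


section \<open>Bases indexed by a family\<close>

definition family_basis ::
  "('k, 'c) ring_scheme \<Rightarrow> ('k, 'b, 'd) module_scheme \<Rightarrow> 'i set \<Rightarrow> ('i \<Rightarrow> 'b) \<Rightarrow> bool" where
  "family_basis K V J b \<longleftrightarrow>
     vectorspace K V \<and> inj_on b J \<and> vectorspace.basis K V (b ` J)"


section \<open>The free algebra on four generators\<close>

datatype 'g free_monoid = Word "'g list"

instantiation free_monoid :: (type) monoid_add
begin

definition zero_free_monoid :: "'a free_monoid" where
  "0 = Word []"

fun plus_free_monoid :: "'a free_monoid \<Rightarrow> 'a free_monoid \<Rightarrow> 'a free_monoid" where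
  "Word u + Word v = Word (u @ v)"

instance
proof
  fix a b c :: "'a free_monoid"
  show "a + b + c = a + (b + c)" by (cases a; cases b; cases c) simp
  show "0 + a = a" "a + 0 = a" by (cases a; simp add: zero_free_monoid_def)+
qed

end

datatype gen = Gen_e | Gen_f | Gen_t | Gen_tinv

text \<open>The monoid algebra of a free monoid is the free algebra. Poly-mappings carry the convolution
  product, so this is a type in class \<open>ring_1\<close>.\<close>

type_synonym 'k free_alg = "gen free_monoid \<Rightarrow>\<^sub>0 'k"

definition gE :: "'k::field free_alg" where "gE = Poly_Mapping.single (Word [Gen_e]) 1"
definition gF :: "'k::field free_alg" where "gF = Poly_Mapping.single (Word [Gen_f]) 1"
definition gT :: "'k::field free_alg" where "gT = Poly_Mapping.single (Word [Gen_t]) 1"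
definition gTinv :: "'k::field free_alg" where "gTinv = Poly_Mapping.single (Word [Gen_tinv]) 1"

definition scal :: "'k::field \<Rightarrow> 'k free_alg" where
  "scal a = Poly_Mapping.single 0 a"


section \<open>The quantum group and its modules\<close>

definition Uq_relations :: "'k::field \<Rightarrow> 'k free_alg set" where
  "Uq_relations q =
    {gT * gTinv - 1,
     gTinv * gT - 1,
     gT * gE * gTinv - scal (q powi 2) * gE,
     gT * gF * gTinv - scal (q powi (-2)) * gF,
     gE * gF - gF * gE - scal (1 / (q - inverse q)) * (gT - gTinv)}"

definition Uq_ideal :: "'k::field \<Rightarrow> 'k free_alg set" where
  "Uq_ideal q = genideal class_ring (Uq_relations q)"

definition Uq :: "'k::field \<Rightarrow> 'k free_alg set ring" where
  "Uq q = class_ring Quot (Uq_ideal q)"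

text \<open>The canonical projection. Elements of \<open>U\<^sub>q\<close> are written below as images of
  noncommutative polynomials in the generators.\<close>

definition toU :: "'k::field \<Rightarrow> 'k free_alg \<Rightarrow> 'k free_alg set" where
  "toU q x = Uq_ideal q +>\<^bsub>class_ring\<^esub> x"

lemma ideal_Uq_ideal: "ideal (Uq_ideal q) class_ring"
  unfolding Uq_ideal_def by (rule ring.genideal_ideal[OF class_ring.ring_axioms]) simp

lemma ring_Uq: "ring (Uq q)"
  unfolding Uq_def by (rule ideal.quotient_is_ring[OF ideal_Uq_ideal])

lemma toU_ring_hom: "toU q \<in> Ring.ring_hom class_ring (Uq q)"
  unfolding Uq_def toU_def[abs_def] by (rule ideal.rcos_ring_hom[OF ideal_Uq_ideal])

lemma toU_carrier: "toU q x \<in> carrier (Uq q)"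
  by (rule Ring.ring_hom_closed[OF toU_ring_hom]) simp

text \<open>The underlying \<open>k\<close>-vector space of a \<open>U\<^sub>q\<close>-module.\<close>

definition vsp :: "'k::field \<Rightarrow> ('k free_alg set, 'b) module \<Rightarrow> ('k, 'b) module" where
  "vsp q M = \<lparr>carrier = carrier M, mult = mult M, one = one M, zero = zero M, add = add M,
              smult = (\<lambda>a x. toU q (scal a) \<odot>\<^bsub>M\<^esub> x)\<rparr>"

lemma vectorspace_vsp:
  assumes "left_module (Uq q) M"
  shows "vectorspace class_ring (vsp q M)"
proof -
  interpret left_module "Uq q" M by fact
  have gr: "abelian_group (vsp q M)"
    by (rule abelian_groupI) (auto simp: vsp_def M.a_ac intro: M.l_neg)
  have add: "toU q (scal (a + b)) = toU q (scal a) \<oplus>\<^bsub>Uq q\<^esub> toU q (scal b)" for a b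
    using ring_hom_add[OF toU_ring_hom, of "scal a" "scal b" q] by (simp add: scal_def single_add)
  have mult: "toU q (scal (a * b)) = toU q (scal a) \<otimes>\<^bsub>Uq q\<^esub> toU q (scal b)" for a b
    using ring_hom_mult[OF toU_ring_hom, of "scal a" "scal b" q]
    by (simp add: scal_def Poly_Mapping.mult_single)
  have one: "toU q (scal 1) = \<one>\<^bsub>Uq q\<^esub>"
    using ring_hom_one[OF toU_ring_hom, of q] by (simp add: scal_def)
  have "Module.module class_ring (vsp q M)"
    by (rule moduleI[OF class_cring.cring_axioms gr])
      (simp_all add: vsp_def add mult one toU_carrier
        smult_closed smult_l_distr smult_r_distr smult_assoc1 smult_one)
  then show ?thesis
    by (intro vectorspace.intro class_field)
qed

definition qint :: "'k::field \<Rightarrow> int \<Rightarrow> 'k" where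
  "qint q m = (q powi m - q powi (-m)) / (q - inverse q)"

definition qfact :: "'k::field \<Rightarrow> nat \<Rightarrow> 'k" where
  "qfact q m = (\<Prod>i=1..m. qint q (int i))"

text \<open>\<open>is_verma q M l v\<close>: the \<open>U\<^sub>q\<close>-module \<open>M\<close> is the Verma module \<open>M(l)\<close> with respect to
  the basis \<open>v\<^sub>0, v\<^sub>1, \<dots>\<close>.\<close>

definition is_verma ::
  "'k::field \<Rightarrow> ('k free_alg set, 'b) module \<Rightarrow> 'k \<Rightarrow> (nat \<Rightarrow> 'b) \<Rightarrow> bool" where
  "is_verma q M l v \<longleftrightarrow>
     l \<noteq> 0 \<and> left_module (Uq q) M \<and> family_basis class_ring (vsp q M) UNIV v \<and>
     (\<forall>i. toU q gT \<odot>\<^bsub>M\<^esub> v i = (q powi (- 2 * int i) * l) \<odot>\<^bsub>vsp q M\<^esub> v i \<and>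
          toU q gF \<odot>\<^bsub>M\<^esub> v i = v (i + 1) \<and>
          toU q gE \<odot>\<^bsub>M\<^esub> v i =
            (qint q (int i) *
              ((q powi (1 - int i) * l - q powi (int i - 1) * inverse l) / (q - inverse q)))
            \<odot>\<^bsub>vsp q M\<^esub> (if i = 0 then \<zero>\<^bsub>M\<^esub> else v (i - 1)))"


section \<open>T modules\<close>

definition casimir :: "'k::field \<Rightarrow> 'k free_alg" where
  "casimir q = scal (1 / (q - inverse q)\<^sup>2) * (scal q * gT + scal (inverse q) * gTinv) + gF * gE"

definition cas_val :: "'k::field \<Rightarrow> nat \<Rightarrow> 'k" where
  "cas_val q n = (q powi (int n + 1) + q powi (- int n - 1)) / (q - inverse q)\<^sup>2"

definition T_ideal :: "'k::field \<Rightarrow> nat \<Rightarrow> 'k \<Rightarrow> 'k free_alg set set" where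
  "T_ideal q n \<epsilon> = gen_left_ideal (Uq q) (toU q `
     {gT - scal (\<epsilon> * q powi (- int n - 2)),
      gE ^ (n + 2),
      (casimir q - scal (\<epsilon> * cas_val q n))\<^sup>2})"

definition T_mod :: "'k::field \<Rightarrow> nat \<Rightarrow> 'k \<Rightarrow> ('k free_alg set, 'k free_alg set set) module" where
  "T_mod q n \<epsilon> = left_quot (Uq q) (T_ideal q n \<epsilon>)"

definition toT :: "'k::field \<Rightarrow> nat \<Rightarrow> 'k \<Rightarrow> 'k free_alg \<Rightarrow> 'k free_alg set set" where
  "toT q n \<epsilon> x = T_ideal q n \<epsilon> +>\<^bsub>Uq q\<^esub> toU q x"

lemma left_module_T_mod: "left_module (Uq q) (T_mod q n \<epsilon>)"
  unfolding T_mod_def T_ideal_def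
  by (intro left_module_left_quot left_ideal_gen_left_ideal ring_Uq image_subsetI toU_carrier)

definition z_elt :: "'k::field \<Rightarrow> nat \<Rightarrow> 'k \<Rightarrow> 'k free_alg" where
  "z_elt q n \<epsilon> =
    (\<Sum>i=0..n. scal (\<epsilon> ^ (n - i) * (qfact q n * qfact q (n - i) / qfact q i)) * gF ^ i * gE ^ i)"

definition v_vec :: "'k::field \<Rightarrow> nat \<Rightarrow> 'k \<Rightarrow> nat \<Rightarrow> 'k free_alg set set" where
  "v_vec q n \<epsilon> i = toT q n \<epsilon> (gF ^ i * gE ^ (n + 1))"

text \<open>\<open>z\<^sub>n = 0\<close> and \<open>z\<^sub>n\<^sub>+\<^sub>1\<^sub>+\<^sub>i = f\<^sup>i z\<close>; indices below \<open>n\<close> are never used.\<close>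

definition z_vec :: "'k::field \<Rightarrow> nat \<Rightarrow> 'k \<Rightarrow> nat \<Rightarrow> 'k free_alg set set" where
  "z_vec q n \<epsilon> i =
    (if i \<le> n then \<zero>\<^bsub>T_mod q n \<epsilon>\<^esub> else toT q n \<epsilon> (gF ^ (i - (n + 1)) * z_elt q n \<epsilon>))"

end

theory Submission
  imports Defs "HOL-Library.Function_Algebras"
begin

text \<open>Let \<open>w\<close> be the image of 1, of weight \<open>\<epsilon> q^(- n - 2)\<close>. On vectors of that weight
  \<open>C - \<epsilon> c\<close> acts as \<open>f e\<close>, so \<open>f e f e w = 0\<close>, and the vectors \<open>f^i e^i w\<close> with
  \<open>1 \<le> i \<le> n + 1\<close> are nonzero multiples of \<open>f e w\<close>. Hence \<open>z\<close> is a nonzero multiple of \<open>w\<close> plus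
  a multiple of \<open>f^(n+1) e^(n+1) w\<close>. The sum \<open>e z\<close> telescopes to \<open>f^n e^(n+1) w\<close>; therefore \<open>z\<close>
  generates the module, and the span of all \<open>v_i\<close> and \<open>z_i\<close> is a submodule containing \<open>w\<close>.
  For linear independence, the claimed formulas define an action of \<open>U_q\<close> on functions on the
  index set in which the basis vector \<open>z_{n+1}\<close> is killed by \<open>I(n, \<epsilon>)\<close>; the induced map
  sends the \<open>v_i\<close> and \<open>z_i\<close> to linearly independent vectors.\<close>

section \<open>Representations of the free algebra\<close>

text \<open>The case \<open>single\<close> includes the coefficient 0 and thereby supplies the zero
  polynomial. Identities additive in each argument thus reduce to monomials.\<close>

lemma poly_mapping_add_induct [case_names single add]:
  fixes P :: "('a \<Rightarrow>\<^sub>0 'b::comm_monoid_add) \<Rightarrow> bool"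
  assumes single: "\<And>m c. P (Poly_Mapping.single m c)"
    and add: "\<And>p r. P p \<Longrightarrow> P r \<Longrightarrow> P (p + r)"
  shows "P p"
proof (induction p rule: update_induct)
  case const
  show ?case using single[of undefined 0] by simp
next
  case (update f a b)
  have "Poly_Mapping.update a b f = f + Poly_Mapping.single a b"
    using update(1) by (intro poly_mapping_eqI)
      (auto simp: lookup_update lookup_add lookup_single when_def in_keys_iff)
  then show ?case using add[OF update(3) single] by simp
qed

text \<open>Any linear operators indexed by the four generators make the space a module over the
  free algebra; the relations of \<open>U_q\<close> are imposed only later, on a concrete
  model.\<close>

locale gen_operators = vector_space scale
  for scale :: "'k::field \<Rightarrow> 'v::ab_group_add \<Rightarrow> 'v" (infixr \<open>*s\<close> 75) +
  fixes g :: "gen \<Rightarrow> 'v \<Rightarrow> 'v"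
  assumes g_add: "g a (x + y) = g a x + g a y"
    and g_scale: "g a (c *s x) = c *s g a x"
begin

lemma g_zero: "g a 0 = 0"
  using g_add[of a 0 0] by simp

fun word_act :: "gen free_monoid \<Rightarrow> 'v \<Rightarrow> 'v" where
  "word_act (Word u) = foldr g u"

definition act :: "'k free_alg \<Rightarrow> 'v \<Rightarrow> 'v" where
  "act p x = (\<Sum>m\<in>Poly_Mapping.keys p. Poly_Mapping.lookup p m *s word_act m x)"

lemma word_act_add: "word_act m (x + y) = word_act m x + word_act m y"
proof (cases m)
  case (Word u)
  have "foldr g u (x + y) = foldr g u x + foldr g u y"
    by (induction u) (simp_all add: g_add)
  with Word show ?thesis by simp
qed

lemma word_act_scale: "word_act m (c *s x) = c *s word_act m x"
proof (cases m)
  case (Word u)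
  have "foldr g u (c *s x) = c *s foldr g u x"
    by (induction u) (simp_all add: g_scale)
  with Word show ?thesis by simp
qed

lemma word_act_plus: "word_act (m + m') x = word_act m (word_act m' x)"
  by (cases m; cases m') simp

text \<open>Key sets can shrink when coefficients cancel; summing over a common finite superset
  makes the actions of different elements comparable.\<close>

lemma act_superset:
  assumes "finite S" "Poly_Mapping.keys p \<subseteq> S"
  shows "act p x = (\<Sum>m\<in>S. Poly_Mapping.lookup p m *s word_act m x)"
  unfolding act_def using assms
  by (intro sum.mono_neutral_left) (auto simp: in_keys_iff)

lemma act_add_left: "act (p + r) x = act p x + act r x"
proof -
  let ?S = "Poly_Mapping.keys p \<union> Poly_Mapping.keys r"
  have "Poly_Mapping.keys (p + r) \<subseteq> ?S" by (rule keys_add)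
  then show ?thesis
    by (simp add: act_superset[of ?S] lookup_add scale_left_distrib sum.distrib)
qed

lemma act_single: "act (Poly_Mapping.single m c) x = c *s word_act m x"
  by (simp add: act_superset[of "{m}"])

lemma act_add: "act p (x + y) = act p x + act p y"
  by (simp add: act_def word_act_add scale_right_distrib sum.distrib)

lemma act_scale: "act p (c *s x) = c *s act p x"
  by (simp add: act_def word_act_scale scale_sum_right mult.commute)

text \<open>Both sides are additive in \<open>p\<close> and in \<open>r\<close>, and for monomials
  the claim is that concatenation of words is composition of operators.\<close>

lemma act_mult: "act (p * r) x = act p (act r x)"
proof (induction p rule: poly_mapping_add_induct)
  case (single m c)
  show ?case
    by (induction r rule: poly_mapping_add_induct)
      (simp_all add: mult_single act_single word_act_plus word_act_scale distrib_left
        act_add_left word_act_add scale_right_distrib)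
next
  case (add p p')
  then show ?case by (simp add: distrib_right act_add_left)
qed

lemma act_0 [simp]: "act 0 x = 0"
  by (simp add: act_def)

lemma act_zero_right [simp]: "act p 0 = 0"
  using act_add[of p 0 0] by simp

lemma act_uminus: "act (- p) x = - act p x"
  using act_add_left[of p "- p" x] by (simp add: eq_neg_iff_add_eq_0 add.commute)

lemma act_diff: "act (p - r) x = act p x - act r x"
  using act_add_left[of p "- r" x] by (simp add: act_uminus)

lemma act_gens [simp]:
  "act gE x = g Gen_e x" "act gF x = g Gen_f x" "act gT x = g Gen_t x" "act gTinv x = g Gen_tinv x"
  by (simp_all add: gE_def gF_def gT_def gTinv_def act_single)

lemma act_scal [simp]: "act (scal c) x = c *s x"
  by (simp add: scal_def act_single zero_free_monoid_def)

lemma act_1 [simp]: "act 1 x = x"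
  using act_scal[of 1 x] by (simp add: scal_def)

lemma act_power: "act (p ^ i) x = (act p ^^ i) x"
  by (induction i) (simp_all add: act_mult)

lemma act_sum: "act (\<Sum>i\<in>A. h i) x = (\<Sum>i\<in>A. act (h i) x)"
  by (induction A rule: infinite_finite_induct) (simp_all add: act_add_left)

lemmas act_simps = act_add_left act_mult act_diff act_add act_scale act_power

text \<open>This lets \<open>Uq_ideal_model\<close> pass from the five relations to the whole
  two-sided ideal that they generate.\<close>

lemma ideal_act_ker: "ideal {p. act p = (\<lambda>x. 0)} class_ring"
proof -
  have "inv\<^bsub>add_monoid class_ring\<^esub> p = - p" for p :: "'k free_alg"
    using class_ring_simps(8)[where 'a = "'k free_alg"] by (simp add: a_inv_def fun_eq_iff)
  then show ?thesis
    by (intro idealI subgroup.intro)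
      (auto simp: act_simps fun_eq_iff class_ring.ring_axioms act_uminus)
qed

end

section \<open>Quantum integers\<close>

locale quantum_parameter =
  fixes q :: "'k::field"
  assumes q_nz: "q \<noteq> 0" and not_root_of_unity: "m > 0 \<Longrightarrow> q ^ m \<noteq> 1"
begin

lemma powi_eq_1_iff [simp]: "q powi m = 1 \<longleftrightarrow> m = 0"
proof
  assume *: "q powi m = 1"
  \<comment> \<open>With both signs at hand, one of the two exponents is the natural number
    \<open>nat \<bar>m\<bar>\<close>.\<close>
  then have "q powi (- m) = 1" by (simp add: power_int_minus)
  with * have "q ^ nat \<bar>m\<bar> = 1"
    by (cases "m \<ge> 0") (simp_all add: power_int_def)
  then show "m = 0" using not_root_of_unity[of "nat \<bar>m\<bar>"] by auto
qed simp

lemma q_diff_nz: "q - inverse q \<noteq> 0"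
proof
  assume "q - inverse q = 0"
  then have "q ^ 2 = 1" using q_nz by (simp add: field_simps power2_eq_square)
  then show False using not_root_of_unity[of 2] by simp
qed

lemma qint_0 [simp]: "qint q 0 = 0"
  by (simp add: qint_def)

lemma qint_1 [simp]: "qint q 1 = 1"
  using q_diff_nz by (simp add: qint_def power_int_minus)

lemma qint_minus: "qint q (- m) = - qint q m"
  by (simp add: qint_def divide_simps)

text \<open>If \<open>[m] = 0\<close> then \<open>q^(2m) = 1\<close>, and \<open>q\<close> is not a
  root of unity.\<close>

lemma qint_eq_0_iff [simp]: "qint q m = 0 \<longleftrightarrow> m = 0"
proof
  assume "qint q m = 0"
  then have "q powi m * q powi m = q powi m * q powi (- m)"
    using q_diff_nz by (simp add: qint_def)
  then have "q powi (m + m) = 1"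
    using q_nz by (simp flip: power_int_add)
  then show "m = 0" by (simp only: powi_eq_1_iff)
qed simp

lemma qfact_nz [simp]: "qfact q m \<noteq> 0"
  by (simp add: qfact_def)

lemma qfact_Suc: "qfact q (Suc m) = qint q (int m + 1) * qfact q m"
  by (simp add: qfact_def add.commute)

text \<open>With \<open>A = q^a\<close> and \<open>B = q^b\<close> this is an identity of Laurent
  polynomials in \<open>A\<close>, \<open>B\<close> and \<open>q\<close>. It yields the coefficients
  in \<open>ef_power\<close> and the commutator relation in \<open>model_ef\<close>.\<close>

lemma qint_mult_diff:
  "qint q (a + 1) * qint q b - qint q a * qint q (b + 1) = qint q (b - a)"
proof -
  define A B d where "A = q powi a" and "B = q powi b" and "d = q - inverse q"
  have nz: "A \<noteq> 0" "B \<noteq> 0" "d \<noteq> 0"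
    using q_nz q_diff_nz by (simp_all add: A_def B_def d_def)
  have *: "(A * q - inverse (A * q)) * (B - inverse B) - (A - inverse A) * (B * q - inverse (B * q))
      = (B * inverse A - A * inverse B) * d"
    using q_nz nz unfolding d_def by (simp add: field_simps)
  have **: "qint q a = (A - inverse A) / d" "qint q b = (B - inverse B) / d"
    "qint q (a + 1) = (A * q - inverse (A * q)) / d" "qint q (b + 1) = (B * q - inverse (B * q)) / d"
    "qint q (b - a) = (B * inverse A - A * inverse B) / d"
    using q_nz by (simp_all add: qint_def A_def B_def d_def power_int_add power_int_diff
        power_int_minus divide_inverse mult.commute)
  have quot: "x / d * (y / d) - u / d * (v / d) = (x * y - u * v) / (d * d)" for x y u v
    by (simp add: diff_divide_distrib)
  have "qint q (a + 1) * qint q b - qint q a * qint q (b + 1)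
      = ((A * q - inverse (A * q)) * (B - inverse B) - (A - inverse A) * (B * q - inverse (B * q))) / (d * d)"
    unfolding ** by (rule quot)
  also have "\<dots> = qint q (b - a)"
    unfolding * ** using nz by simp
  finally show ?thesis .
qed

end

locale T_parameters = quantum_parameter q for q :: "'k::field" +
  fixes \<epsilon> :: 'k and n :: nat
  assumes \<epsilon>: "\<epsilon> = 1 \<or> \<epsilon> = - 1"
begin

lemma \<epsilon>_sq [simp]: "\<epsilon> * \<epsilon> = 1" and \<epsilon>_nz [simp]: "\<epsilon> \<noteq> 0" and inverse_\<epsilon> [simp]: "inverse \<epsilon> = \<epsilon>"
  using \<epsilon> by auto

lemma \<epsilon>_sq_left [simp]: "\<epsilon> * (\<epsilon> * x) = x"
  using \<epsilon>_sq by (simp flip: mult.assoc)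

end

section \<open>Computing in \<open>U\<^sub>q\<close> and in the T modules\<close>

lemma scal_mult: "scal a * scal b = scal (a * b)"
  by (simp add: scal_def mult_single)

lemma scal_add: "scal a + scal b = scal (a + b)"
  by (simp add: scal_def single_add)

lemma scal_0 [simp]: "scal 0 = 0"
  by (simp add: scal_def)

lemma scal_1 [simp]: "scal 1 = 1"
  by (simp add: scal_def)

lemma scal_uminus: "scal (- a) = - scal a"
  by (simp add: scal_def single_uminus)

lemma scal_diff: "scal a - scal b = scal (a - b)"
  by (simp add: scal_def single_diff)

lemma scal_commute: "x * scal c = scal c * x"
  by (induction x rule: poly_mapping_add_induct)
    (simp_all add: scal_def mult_single distrib_left distrib_right mult.commute)

lemma scal_left_commute: "x * (scal c * y) = scal c * (x * y)"
  by (metis mult.assoc scal_commute)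

lemma scal_mult_left: "scal a * (scal b * x) = scal (a * b) * x"
  by (simp add: scal_mult flip: mult.assoc)

lemma toU_eq_iff: "toU q x = toU q y \<longleftrightarrow> x - y \<in> Uq_ideal q"
  using ring.quotient_eq_iff_same_a_r_cos[OF class_ring.ring_axioms ideal_Uq_ideal, of x y q]
  by (simp add: toU_def class_ring_simps)

lemma toU_mult: "toU q x \<otimes>\<^bsub>Uq q\<^esub> toU q y = toU q (x * y)"
  using ring_hom_mult[OF toU_ring_hom, of x y q] by simp

lemma toU_add: "toU q x \<oplus>\<^bsub>Uq q\<^esub> toU q y = toU q (x + y)"
  using ring_hom_add[OF toU_ring_hom, of x y q] by simp

lemma toU_one: "\<one>\<^bsub>Uq q\<^esub> = toU q 1"
  using ring_hom_one[OF toU_ring_hom, of q] by simp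

lemma toU_zero: "\<zero>\<^bsub>Uq q\<^esub> = toU q 0"
  using ring_hom_zero[OF toU_ring_hom class_ring.ring_axioms ring_Uq, of q] by simp

lemma toU_uminus: "\<ominus>\<^bsub>Uq q\<^esub> toU q x = toU q (- x)"
proof -
  interpret ring "Uq q" by (rule ring_Uq)
  show ?thesis
    by (rule minus_equality) (simp_all add: toU_add toU_zero toU_carrier)
qed

lemma carrier_Uq: "carrier (Uq q) = range (toU q)"
  by (auto simp: Uq_def FactRing_def A_RCOSETS_def' toU_def class_ring_simps)

lemma left_ideal_T_ideal: "left_ideal (T_ideal q n \<epsilon>) (Uq q)"
  unfolding T_ideal_def by (intro left_ideal_gen_left_ideal ring_Uq image_subsetI toU_carrier)

lemma abelian_subgroup_T_ideal: "abelian_subgroup (T_ideal q n \<epsilon>) (Uq q)"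
proof -
  interpret left_ideal "T_ideal q n \<epsilon>" "Uq q" by (rule left_ideal_T_ideal)
  show ?thesis by (intro abelian_subgroupI3 additive_subgroup_axioms abelian_group_axioms)
qed

text \<open>Elements of a T module are cosets of cosets; the computations below take place on
  representatives in the free algebra.\<close>

lemma toT_eq_iff: "toT q n \<epsilon> x = toT q n \<epsilon> y \<longleftrightarrow> toU q (x - y) \<in> T_ideal q n \<epsilon>"
proof -
  interpret abelian_subgroup "T_ideal q n \<epsilon>" "Uq q" by (rule abelian_subgroup_T_ideal)
  have "toU q x \<ominus>\<^bsub>Uq q\<^esub> toU q y = toU q (x - y)"
    by (simp add: a_minus_def toU_uminus toU_add)
  then have "toU q x \<in> T_ideal q n \<epsilon> +>\<^bsub>Uq q\<^esub> toU q y \<longleftrightarrow> toU q (x - y) \<in> T_ideal q n \<epsilon>"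
    using a_rcos_module_minus[OF ring_Uq toU_carrier toU_carrier, of x y] by simp
  then show ?thesis unfolding toT_def
    by (metis a_repr_independence' a_rcos_self toU_carrier)
qed

lemma carrier_T_mod: "carrier (T_mod q n \<epsilon>) = range (toT q n \<epsilon>)"
  by (auto simp: T_mod_def left_quot_def A_RCOSETS_def' toT_def carrier_Uq)

lemma toT_carrier [simp]: "toT q n \<epsilon> x \<in> carrier (T_mod q n \<epsilon>)"
  by (simp add: carrier_T_mod)

lemma smult_toT: "toU q a \<odot>\<^bsub>T_mod q n \<epsilon>\<^esub> toT q n \<epsilon> x = toT q n \<epsilon> (a * x)"
  unfolding T_mod_def toT_def
  by (simp add: left_quot_smult[OF left_ideal_T_ideal toU_carrier toU_carrier] toU_mult)

lemma add_toT: "toT q n \<epsilon> x \<oplus>\<^bsub>T_mod q n \<epsilon>\<^esub> toT q n \<epsilon> y = toT q n \<epsilon> (x + y)"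
proof -
  interpret abelian_subgroup "T_ideal q n \<epsilon>" "Uq q" by (rule abelian_subgroup_T_ideal)
  show ?thesis
    using a_rcos_sum[OF toU_carrier toU_carrier, of x y]
    by (simp add: T_mod_def left_quot_def toT_def toU_add)
qed

lemma zero_toT: "\<zero>\<^bsub>T_mod q n \<epsilon>\<^esub> = toT q n \<epsilon> 0"
proof -
  interpret left_module "Uq q" "T_mod q n \<epsilon>" by (rule left_module_T_mod)
  have "toT q n \<epsilon> 0 = \<zero>\<^bsub>T_mod q n \<epsilon>\<^esub>"
    using M.add.l_cancel_one[OF toT_carrier toT_carrier, of 0 0] by (simp add: add_toT)
  then show ?thesis by simp
qed

lemma vsp_sel [simp]:
  "carrier (vsp q M) = carrier M" "zero (vsp q M) = zero M" "add (vsp q M) = add M"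
  "smult (vsp q M) c x = toU q (scal c) \<odot>\<^bsub>M\<^esub> x"
  by (simp_all add: vsp_def)

text \<open>\<open>T_ideal\<close> is a left ideal, so the generators of \<open>T_ideal\<close> may
  be used at the right end of a product. The relations of \<open>U_q\<close> generate a two-sided
  ideal, and \<open>Uq_relation_toT\<close> therefore permits a further factor on the right.\<close>

lemma toT_mult_cong: "toT q n \<epsilon> x = toT q n \<epsilon> y \<Longrightarrow> toT q n \<epsilon> (a * x) = toT q n \<epsilon> (a * y)"
  by (metis smult_toT)

lemma toT_add_cong:
  "toT q n \<epsilon> x = toT q n \<epsilon> x' \<Longrightarrow> toT q n \<epsilon> y = toT q n \<epsilon> y' \<Longrightarrow>
   toT q n \<epsilon> (x + y) = toT q n \<epsilon> (x' + y')"
  by (metis add_toT)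

lemma toT_sum_cong:
  "(\<And>i. i \<in> A \<Longrightarrow> toT q n \<epsilon> (x i) = toT q n \<epsilon> (y i)) \<Longrightarrow>
   toT q n \<epsilon> (\<Sum>i\<in>A. x i) = toT q n \<epsilon> (\<Sum>i\<in>A. y i)"
proof (induction A rule: infinite_finite_induct)
  case (insert i A)
  then have "toT q n \<epsilon> (x i + sum x A) = toT q n \<epsilon> (y i + sum y A)"
    by (intro toT_add_cong) simp_all
  then show ?case using insert.hyps by simp
qed simp_all

lemma Uq_relation_toT:
  assumes "x - y \<in> Uq_relations q"
  shows "toT q n \<epsilon> (x * a) = toT q n \<epsilon> (y * a)"
proof -
  have "x - y \<in> Uq_ideal q"
    unfolding Uq_ideal_def
    using ring.genideal_self[OF class_ring.ring_axioms, of "Uq_relations q"] assms by auto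
  then have "(x - y) * a \<in> Uq_ideal q"
    using ideal.I_r_closed[OF ideal_Uq_ideal, of "x - y" q a] by simp
  then have "toU q (x * a - y * a) = toU q 0"
    by (simp add: toU_eq_iff left_diff_distrib)
  then show ?thesis
    using additive_subgroup.zero_closed[OF left_ideal.axioms(1)[OF left_ideal_T_ideal], of q n \<epsilon>]
    by (simp add: toT_eq_iff toU_zero)
qed

lemma T_generator_toT:
  assumes "x \<in> {gT - scal (\<epsilon> * q powi (- int n - 2)), gE ^ (n + 2),
      (casimir q - scal (\<epsilon> * cas_val q n))\<^sup>2}"
  shows "toT q n \<epsilon> x = toT q n \<epsilon> 0"
  using assms by (auto simp: toT_eq_iff T_ideal_def gen_left_ideal_def)

lemma toT_diff_cong:
  assumes "toT q n \<epsilon> x = toT q n \<epsilon> x'" "toT q n \<epsilon> y = toT q n \<epsilon> y'"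
  shows "toT q n \<epsilon> (x - y) = toT q n \<epsilon> (x' - y')"
  using toT_add_cong[OF assms(1) toT_mult_cong[OF assms(2), of "- 1"]] by simp

lemma scal_sum: "scal (\<Sum>i\<in>A. h i) = (\<Sum>i\<in>A. scal (h i))"
  by (induction A rule: infinite_finite_induct) (simp_all flip: scal_add)

section \<open>Bases and submodules\<close>

text \<open>If a linear map \<open>\<Phi>\<close> into functions sends the family to an independent
  one, the family itself is independent. Since independence is stated over indices and not over the
  set of values, it also yields injectivity.\<close>

lemma family_basisI:
  fixes V :: "('k::field, 'b, 'd) module_scheme" and b :: "'i \<Rightarrow> 'b" and \<Phi> :: "'b \<Rightarrow> 's \<Rightarrow> 'k"
  assumes V: "vectorspace class_ring V" and b: "range b \<subseteq> carrier V"
    and gen: "LinearCombinations.module.span class_ring V (range b) = carrier V"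
    and \<Phi>_add: "\<And>x y. x \<in> carrier V \<Longrightarrow> y \<in> carrier V \<Longrightarrow> \<Phi> (x \<oplus>\<^bsub>V\<^esub> y) = (\<lambda>s. \<Phi> x s + \<Phi> y s)"
    and \<Phi>_smult: "\<And>c x. x \<in> carrier V \<Longrightarrow> \<Phi> (c \<odot>\<^bsub>V\<^esub> x) = (\<lambda>s. c * \<Phi> x s)"
    and indep: "\<And>A c i. finite A \<Longrightarrow> (\<And>s. (\<Sum>i\<in>A. c i * \<Phi> (b i) s) = 0) \<Longrightarrow> i \<in> A \<Longrightarrow> c i = 0"
  shows "family_basis class_ring V UNIV b"
proof -
  interpret vectorspace class_ring V by (rule V)
  have inj: "inj b"
  proof (rule injI, rule ccontr)
    fix i j assume *: "b i = b j" "i \<noteq> j"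
    \<comment> \<open>If two indices carry the same vector, the coefficients 1 and -1 give a
      vanishing combination.\<close>
    define c :: "'i \<Rightarrow> 'k" where "c l = (if l = i then 1 else - 1)" for l
    have "(\<Sum>l\<in>{i, j}. c l * \<Phi> (b l) s) = 0" for s
      using * by (simp add: c_def)
    then have "c i = 0" using indep[of "{i, j}" c i] by simp
    then show False by (simp add: c_def)
  qed
  have \<Phi>_0: "\<Phi> \<zero>\<^bsub>V\<^esub> s = 0" for s
  proof -
    have "\<Phi> \<zero>\<^bsub>V\<^esub> s = \<Phi> \<zero>\<^bsub>V\<^esub> s + \<Phi> \<zero>\<^bsub>V\<^esub> s"
      using fun_cong[OF \<Phi>_add[OF zero_closed zero_closed], of s] by (simp only: l_zero zero_closed)
    then show ?thesis by (simp only: add_cancel_right_right)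
  qed
  have \<Phi>_finsum: "\<Phi> (finsum V h A) s = (\<Sum>v\<in>A. \<Phi> (h v) s)"
    if "finite A" "h \<in> A \<rightarrow> carrier V" for h A s
    using that
  proof (induction A rule: finite_induct)
    case (insert v A)
    then have "finsum V h (insert v A) = h v \<oplus>\<^bsub>V\<^esub> finsum V h A"
      by (intro finsum_insert) auto
    with insert show ?case by (simp add: \<Phi>_add Pi_iff)
  qed (simp add: \<Phi>_0)
  have "\<not> lin_dep (range b)"
  proof
    assume "lin_dep (range b)"
    then obtain A a v where A: "finite A" "A \<subseteq> range b" and lc: "lincomb a A = \<zero>\<^bsub>V\<^esub>"
      and v: "v \<in> A" "a v \<noteq> 0"
      unfolding lin_dep_def by (auto simp: class_ring_simps)
    obtain A' where A': "A = b ` A'"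
      using A(2) by (auto simp: subset_image_iff)
    have "finite A'"
      using A(1) A' inj finite_imageD inj_on_subset by blast
    moreover have "(\<Sum>i\<in>A'. a (b i) * \<Phi> (b i) s) = 0" for s
    proof -
      have "\<Phi> (lincomb a A) s = (\<Sum>v\<in>A. a v * \<Phi> v s)"
        unfolding lincomb_def using A b
        by (subst \<Phi>_finsum) (auto simp: \<Phi>_smult subset_iff intro!: sum.cong smult_closed)
      also have "\<dots> = (\<Sum>i\<in>A'. a (b i) * \<Phi> (b i) s)"
        unfolding A' using inj by (subst sum.reindex) (auto intro: inj_on_subset)
      finally show ?thesis by (simp add: lc \<Phi>_0)
    qed
    moreover obtain i where "i \<in> A'" "v = b i" using v A' by blast
    ultimately have "a v = 0" using indep[of A' "\<lambda>i. a (b i)" i] by blast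
    with v show False by simp
  qed
  with inj b gen show ?thesis
    using V by (simp add: family_basis_def basis_def)
qed

lemma free_alg_induct [case_names scal add mult gens]:
  fixes P :: "'k::field free_alg \<Rightarrow> bool"
  assumes scal: "\<And>c. P (scal c)"
    and add: "\<And>p r. P p \<Longrightarrow> P r \<Longrightarrow> P (p + r)"
    and mult: "\<And>p r. P p \<Longrightarrow> P r \<Longrightarrow> P (p * r)"
    and gens: "P gE" "P gF" "P gT" "P gTinv"
  shows "P p"
proof (induction p rule: poly_mapping_add_induct)
  case (single m c)
  obtain u where m: "m = Word u" by (cases m)
  have gen: "P (Poly_Mapping.single (Word [a]) 1)" for a
    using gens by (cases a) (simp_all add: gE_def gF_def gT_def gTinv_def)
  have "P (Poly_Mapping.single (Word u) c)"
  proof (induction u)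
    case Nil
    then show ?case using scal[of c] by (simp add: scal_def zero_free_monoid_def)
  next
    case (Cons a u)
    then show ?case using mult[OF gen[of a] Cons] by (simp add: mult_single)
  qed
  then show ?case by (simp add: m)
qed (rule add)

text \<open>Testing the four generators on \<open>S\<close> suffices: linearity extends the test to
  the span, and \<open>free_alg_induct\<close> extends it to all of \<open>U_q\<close>.\<close>

lemma submodule_span:
  assumes M: "left_module (Uq q) M" and S: "S \<subseteq> carrier M"
    and gens: "\<And>a x. a \<in> {gE, gF, gT, gTinv} \<Longrightarrow> x \<in> S \<Longrightarrow>
      toU q a \<odot>\<^bsub>M\<^esub> x \<in> LinearCombinations.module.span class_ring (vsp q M) S"
  shows "Module.submodule (LinearCombinations.module.span class_ring (vsp q M) S) (Uq q) M"
proof -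
  interpret M: left_module "Uq q" M by (rule M)
  interpret V: vectorspace class_ring "vsp q M" by (rule vectorspace_vsp[OF M])
  let ?N = "V.span S"
  have N: "LinearCombinations.submodule class_ring ?N (vsp q M)"
    using S by (intro V.span_is_submodule) simp
  have NM: "?N \<subseteq> carrier M"
    using LinearCombinations.submodule.subset[OF N] by simp
  have N_add: "x \<oplus>\<^bsub>M\<^esub> y \<in> ?N" if "x \<in> ?N" "y \<in> ?N" for x y
    using LinearCombinations.submodule.m_closed[OF N that] by simp
  have N_scal: "toU q (scal c) \<odot>\<^bsub>M\<^esub> x \<in> ?N" if "x \<in> ?N" for x c
    using LinearCombinations.submodule.smult_closed[OF N _ that, of c] by (simp add: class_ring_simps)
  have N_0: "\<zero>\<^bsub>M\<^esub> \<in> ?N"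
    using LinearCombinations.submodule.zero_closed[OF N] by simp
  have U_commute: "toU q (scal c) \<odot>\<^bsub>M\<^esub> (toU q a \<odot>\<^bsub>M\<^esub> x) = toU q a \<odot>\<^bsub>M\<^esub> (toU q (scal c) \<odot>\<^bsub>M\<^esub> x)"
    if "x \<in> carrier M" for a c x
    using M.smult_assoc1[OF toU_carrier toU_carrier that, symmetric]
    by (simp only: toU_mult scal_commute[of a])
  have gens_N: "toU q a \<odot>\<^bsub>M\<^esub> x \<in> ?N" if a: "a \<in> {gE, gF, gT, gTinv}" and x: "x \<in> ?N" for a x
  proof -
    \<comment> \<open>The preimage of the span under \<open>a\<close> is a subspace containing
      \<open>S\<close>, hence contains the span.\<close>
    let ?L = "{x \<in> carrier M. toU q a \<odot>\<^bsub>M\<^esub> x \<in> ?N}"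
    have zero: "toU q a \<odot>\<^bsub>M\<^esub> \<zero>\<^bsub>M\<^esub> = \<zero>\<^bsub>M\<^esub>"
    proof -
      have u: "toU q a \<odot>\<^bsub>M\<^esub> \<zero>\<^bsub>M\<^esub> \<in> carrier M"
        by (intro M.smult_closed toU_carrier M.M.zero_closed)
      have "toU q a \<odot>\<^bsub>M\<^esub> \<zero>\<^bsub>M\<^esub> \<oplus>\<^bsub>M\<^esub> toU q a \<odot>\<^bsub>M\<^esub> \<zero>\<^bsub>M\<^esub> = toU q a \<odot>\<^bsub>M\<^esub> \<zero>\<^bsub>M\<^esub>"
        using M.smult_r_distr[OF toU_carrier[of q a] M.M.zero_closed M.M.zero_closed] by simp
      then show ?thesis using M.M.add.l_cancel_one[OF u u] by blast
    qed
    have "LinearCombinations.submodule class_ring ?L (vsp q M)"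
    proof (intro LinearCombinations.submodule.intro V.module_axioms)
      fix x y assume "x \<in> ?L" "y \<in> ?L"
      then show "x \<oplus>\<^bsub>vsp q M\<^esub> y \<in> ?L"
        by (simp add: M.smult_r_distr toU_carrier N_add)
    next
      fix c x assume "x \<in> ?L"
      then show "c \<odot>\<^bsub>vsp q M\<^esub> x \<in> ?L"
        using N_scal[of "toU q a \<odot>\<^bsub>M\<^esub> x" c] U_commute[of x c a]
        by (simp add: M.smult_closed toU_carrier)
    qed (auto simp: zero N_0)
    moreover have "S \<subseteq> ?L" using S gens[OF a] by auto
    ultimately show ?thesis using V.span_is_subset[of S ?L] x by auto
  qed
  have U_N: "\<forall>x\<in>?N. toU q p \<odot>\<^bsub>M\<^esub> x \<in> ?N" for p
  proof (induction p rule: free_alg_induct)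
    case (add p r)
    show ?case
    proof
      fix x assume "x \<in> ?N"
      then have "toU q p \<odot>\<^bsub>M\<^esub> x \<oplus>\<^bsub>M\<^esub> toU q r \<odot>\<^bsub>M\<^esub> x \<in> ?N" "x \<in> carrier M"
        using add NM by (auto intro: N_add)
      then show "toU q (p + r) \<odot>\<^bsub>M\<^esub> x \<in> ?N"
        using M.smult_l_distr[OF toU_carrier[of q p] toU_carrier[of q r]] by (simp only: toU_add)
    qed
  next
    case (mult p r)
    show ?case
    proof
      fix x assume "x \<in> ?N"
      then have "toU q p \<odot>\<^bsub>M\<^esub> (toU q r \<odot>\<^bsub>M\<^esub> x) \<in> ?N" "x \<in> carrier M"
        using mult NM by auto
      then show "toU q (p * r) \<odot>\<^bsub>M\<^esub> x \<in> ?N"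
        using M.smult_assoc1[OF toU_carrier[of q p] toU_carrier[of q r]] by (simp only: toU_mult)
    qed
  qed (auto intro: N_scal gens_N)
  \<comment> \<open>The negative of \<open>x\<close> is the action of -1 on \<open>x\<close>, so
    \<open>U_N\<close> applies.\<close>
  have N_minus: "\<ominus>\<^bsub>M\<^esub> x \<in> ?N" if x: "x \<in> ?N" for x
  proof -
    have xM: "x \<in> carrier M" using x NM by auto
    have closed: "toU q a \<odot>\<^bsub>M\<^esub> x \<in> carrier M" for a
      by (intro M.smult_closed toU_carrier xM)
    have "toU q 0 \<odot>\<^bsub>M\<^esub> x \<oplus>\<^bsub>M\<^esub> toU q 0 \<odot>\<^bsub>M\<^esub> x = toU q 0 \<odot>\<^bsub>M\<^esub> x"
      using M.smult_l_distr[OF toU_carrier[of q 0] toU_carrier[of q 0] xM] by (simp add: toU_add)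
    then have zero: "toU q 0 \<odot>\<^bsub>M\<^esub> x = \<zero>\<^bsub>M\<^esub>"
      using M.M.add.l_cancel_one[OF closed closed] by blast
    have "toU q (- 1) \<odot>\<^bsub>M\<^esub> x \<oplus>\<^bsub>M\<^esub> toU q 1 \<odot>\<^bsub>M\<^esub> x = \<zero>\<^bsub>M\<^esub>"
      using M.smult_l_distr[OF toU_carrier[of q "- 1"] toU_carrier[of q 1] xM]
      by (simp add: toU_add zero)
    then have "toU q (- 1) \<odot>\<^bsub>M\<^esub> x \<oplus>\<^bsub>M\<^esub> x = \<zero>\<^bsub>M\<^esub>"
      using M.smult_one[OF xM] by (simp add: toU_one)
    then have "\<ominus>\<^bsub>M\<^esub> x = toU q (- 1) \<odot>\<^bsub>M\<^esub> x"
      using M.M.minus_equality[OF _ xM closed] by simp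
    with U_N x show ?thesis by simp
  qed
  show ?thesis
  proof (intro Module.submodule.intro submodule_axioms.intro M.add.subgroupI)
    show "?N \<noteq> {}" using N_0 by blast
    show "a \<odot>\<^bsub>M\<^esub> x \<in> ?N" if "a \<in> carrier (Uq q)" "x \<in> ?N" for a x
      using that U_N by (auto simp: carrier_Uq)
  qed (use NM N_add N_minus in \<open>auto simp: a_inv_def\<close>)
qed

lemma left_module_submodule:
  assumes "left_module R M" "Module.submodule N R M"
  shows "left_module R (M\<lparr>carrier := N\<rparr>)"
proof -
  interpret left_module R M by fact
  interpret N: Module.submodule N R M by fact
  have NM: "x \<in> carrier M" if "x \<in> N" for x
    using N.subset that by auto
  have "abelian_group (M\<lparr>carrier := N\<rparr>)"
  proof (rule abelian_groupI)
    fix x assume "x \<in> carrier (M\<lparr>carrier := N\<rparr>)"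
    then have x: "x \<in> N" by simp
    then have "\<ominus>\<^bsub>M\<^esub> x \<in> N" "\<ominus>\<^bsub>M\<^esub> x \<oplus>\<^bsub>M\<^esub> x = \<zero>\<^bsub>M\<^esub>"
      using N.m_inv_closed[OF x] NM by (simp_all add: a_inv_def[of M, symmetric] M.l_neg)
    then show "\<exists>y\<in>carrier (M\<lparr>carrier := N\<rparr>). y \<oplus>\<^bsub>M\<lparr>carrier := N\<rparr>\<^esub> x = \<zero>\<^bsub>M\<lparr>carrier := N\<rparr>\<^esub>"
      by auto
  qed (use N.m_closed N.one_closed NM in \<open>auto simp: M.a_ac\<close>)
  then show ?thesis
    by (intro left_module.intro left_module_axioms.intro R.ring_axioms)
      (auto simp: NM smult_l_distr smult_r_distr smult_assoc1 smult_one)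
qed

section \<open>Weight vectors in T modules\<close>

context T_parameters
begin

abbreviation \<tau> :: "'k free_alg \<Rightarrow> 'k free_alg set set" where
  "\<tau> \<equiv> toT q n \<epsilon>"

text \<open>All weights considered carry the same sign \<open>\<epsilon>\<close>, so only the
  exponent is recorded. A representative of zero has every weight.\<close>

definition wt :: "int \<Rightarrow> 'k free_alg \<Rightarrow> bool" where
  "wt m x \<longleftrightarrow> \<tau> (gT * x) = \<tau> (scal (\<epsilon> * q powi m) * x)"

lemma tinv_t: "\<tau> (a * (gTinv * (gT * x))) = \<tau> (a * x)"
  using Uq_relation_toT[of "gTinv * gT" 1 q n \<epsilon> x]
  by (intro toT_mult_cong) (simp add: Uq_relations_def mult.assoc)

lemma wt_tinv:
  assumes "wt m x"
  shows "\<tau> (gTinv * x) = \<tau> (scal (\<epsilon> * q powi (- m)) * x)"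
proof -
  have "\<tau> (scal (\<epsilon> * q powi (- m)) * x) = \<tau> (scal (\<epsilon> * q powi (- m)) * gTinv * (gT * x))"
    using tinv_t[of "scal (\<epsilon> * q powi (- m))" x] by (simp add: mult.assoc)
  also have "\<dots> = \<tau> (scal (\<epsilon> * q powi (- m)) * gTinv * (scal (\<epsilon> * q powi m) * x))"
    using assms unfolding wt_def by (rule toT_mult_cong)
  also have "scal (\<epsilon> * q powi (- m)) * gTinv * (scal (\<epsilon> * q powi m) * x)
      = scal ((\<epsilon> * q powi (- m)) * (\<epsilon> * q powi m)) * (gTinv * x)"
    by (simp only: mult.assoc scal_left_commute[of gTinv] scal_mult_left)
  also have "(\<epsilon> * q powi (- m)) * (\<epsilon> * q powi m) = 1"
    using q_nz by (simp add: power_int_minus mult_ac)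
  finally show ?thesis by simp
qed

text \<open>Inserting \<open>gTinv * gT\<close> in front of \<open>x\<close> exposes the conjugate
  of \<open>g\<close> by \<open>gT\<close>; the shift \<open>d\<close> is 2 for \<open>gE\<close>
  and -2 for \<open>gF\<close>.\<close>

lemma wt_conj:
  assumes "wt m x" "gT * g * gTinv - scal (q powi d) * g \<in> Uq_relations q"
  shows "wt (m + d) (g * x)"
proof -
  have "\<tau> (gT * (g * x)) = \<tau> (gT * g * gTinv * (gT * x))"
    using tinv_t[of "gT * g" x] by (simp add: mult.assoc)
  also have "\<dots> = \<tau> (scal (q powi d) * g * (gT * x))"
    by (rule Uq_relation_toT[OF assms(2)])
  also have "\<dots> = \<tau> (scal (q powi d) * g * (scal (\<epsilon> * q powi m) * x))"
    using assms(1) unfolding wt_def by (rule toT_mult_cong)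
  also have "scal (q powi d) * g * (scal (\<epsilon> * q powi m) * x) = scal (q powi d * (\<epsilon> * q powi m)) * (g * x)"
    by (simp only: mult.assoc scal_left_commute[of g] scal_mult_left)
  also have "q powi d * (\<epsilon> * q powi m) = \<epsilon> * q powi (m + d)"
    using q_nz by (simp add: power_int_add)
  finally show ?thesis unfolding wt_def .
qed

lemma wt_e: "wt m x \<Longrightarrow> wt (m + 2) (gE * x)"
  by (rule wt_conj) (simp_all add: Uq_relations_def)

lemma wt_f: "wt m x \<Longrightarrow> wt (m - 2) (gF * x)"
  using wt_conj[of m x gF "-2"] by (simp add: Uq_relations_def)

lemma wt_e_power: "wt m x \<Longrightarrow> wt (m + 2 * int i) (gE ^ i * x)"
proof (induction i)
  case (Suc i)
  then show ?case using wt_e[of "m + 2 * int i" "gE ^ i * x"] by (simp add: mult.assoc algebra_simps)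
qed simp

lemma wt_f_power: "wt m x \<Longrightarrow> wt (m - 2 * int i) (gF ^ i * x)"
proof (induction i)
  case (Suc i)
  then show ?case using wt_f[of "m - 2 * int i" "gF ^ i * x"] by (simp add: mult.assoc algebra_simps)
qed simp

lemma wt_scal: "wt m x \<Longrightarrow> wt m (scal c * x)"
  using toT_mult_cong[of q n \<epsilon> "gT * x" "scal (\<epsilon> * q powi m) * x" "scal c"]
  by (simp add: wt_def scal_left_commute[of gT] scal_mult_left mult.commute)

lemma wt_sum: "(\<And>i. i \<in> A \<Longrightarrow> wt m (x i)) \<Longrightarrow> wt m (\<Sum>i\<in>A. x i)"
  unfolding wt_def sum_distrib_left by (rule toT_sum_cong)

lemma wt_1: "wt (- int n - 2) 1"
proof -
  have "\<tau> (gT - scal (\<epsilon> * q powi (- int n - 2)) + scal (\<epsilon> * q powi (- int n - 2)))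
      = \<tau> (0 + scal (\<epsilon> * q powi (- int n - 2)))"
    by (intro toT_add_cong T_generator_toT) simp_all
  then show ?thesis by (simp add: wt_def)
qed

text \<open>On weight \<open>m\<close> the right-hand side of the commutator relation is the scalar
  \<open>\<epsilon> [m]\<close>.\<close>

lemma ef:
  assumes "wt m x"
  shows "\<tau> (gE * (gF * x)) = \<tau> (gF * (gE * x) + scal (\<epsilon> * qint q m) * x)"
proof -
  let ?c = "1 / (q - inverse q)"
  have "\<tau> ((gE * gF - gF * gE) * x) = \<tau> (scal ?c * (gT - gTinv) * x)"
    by (rule Uq_relation_toT) (simp add: Uq_relations_def)
  also have "scal ?c * (gT - gTinv) * x = scal ?c * (gT * x - gTinv * x)"
    by (simp add: mult.assoc left_diff_distrib)
  also have "\<tau> \<dots> = \<tau> (scal ?c * (scal (\<epsilon> * q powi m) * x - scal (\<epsilon> * q powi (- m)) * x))"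
    using assms by (intro toT_mult_cong toT_diff_cong wt_tinv) (simp_all add: wt_def)
  also have "scal ?c * (scal (\<epsilon> * q powi m) * x - scal (\<epsilon> * q powi (- m)) * x)
      = scal (\<epsilon> * qint q m) * x"
    by (simp only: left_diff_distrib[symmetric] scal_diff scal_mult_left)
      (simp add: qint_def right_diff_distrib diff_divide_distrib)
  finally have "\<tau> (gF * (gE * x) + (gE * gF - gF * gE) * x)
      = \<tau> (gF * (gE * x) + scal (\<epsilon> * qint q m) * x)"
    by (intro toT_add_cong refl)
  then show ?thesis by (simp add: left_diff_distrib mult.assoc)
qed

text \<open>Each further \<open>f\<close> moves past \<open>e\<close> at the cost of
  \<open>\<epsilon> [m - 2i]\<close>, and \<open>[i][m+1-i] + [m-2i] = [i+1][m-i]\<close> by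
  \<open>qint_mult_diff\<close>. At \<open>i = 0\<close> the coefficient has the factor
  \<open>[0]\<close>, so the truncated exponent \<open>i - 1\<close> does no harm.\<close>

lemma ef_power:
  assumes "wt m x"
  shows "\<tau> (gE * (gF ^ i * x)) =
    \<tau> (gF ^ i * (gE * x) + scal (\<epsilon> * qint q (int i) * qint q (m + 1 - int i)) * (gF ^ (i - 1) * x))"
proof (induction i)
  case (Suc i)
  let ?c = "\<epsilon> * qint q (int i) * qint q (m + 1 - int i)"
  have "\<tau> (gE * (gF ^ Suc i * x)) = \<tau> (gE * (gF * (gF ^ i * x)))"
    by (simp add: mult.assoc)
  also have "\<dots> = \<tau> (gF * (gE * (gF ^ i * x)) + scal (\<epsilon> * qint q (m - 2 * int i)) * (gF ^ i * x))"
    by (rule ef[OF wt_f_power[OF assms]])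
  also have "\<dots> = \<tau> (gF * (gF ^ i * (gE * x) + scal ?c * (gF ^ (i - 1) * x))
      + scal (\<epsilon> * qint q (m - 2 * int i)) * (gF ^ i * x))"
    by (intro toT_add_cong toT_mult_cong Suc refl)
  also have "gF * (gF ^ i * (gE * x) + scal ?c * (gF ^ (i - 1) * x))
      = gF ^ Suc i * (gE * x) + scal ?c * (gF ^ i * x)"
    by (cases i) (simp_all add: distrib_left scal_left_commute[of gF] mult.assoc)
  also have "\<dots> + scal (\<epsilon> * qint q (m - 2 * int i)) * (gF ^ i * x)
      = gF ^ Suc i * (gE * x) + scal (?c + \<epsilon> * qint q (m - 2 * int i)) * (gF ^ i * x)"
    by (simp add: distrib_right flip: scal_add)
  also have "?c + \<epsilon> * qint q (m - 2 * int i) = \<epsilon> * qint q (int (Suc i)) * qint q (m + 1 - int (Suc i))"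
  proof -
    have "qint q (m - 2 * int i) = qint q (int i + 1) * qint q (m - int i) - qint q (int i) * qint q (m - int i + 1)"
      unfolding qint_mult_diff by simp
    moreover have "m + 1 - int i = m - int i + 1" "m + 1 - int (Suc i) = m - int i" "int (Suc i) = int i + 1"
      by simp_all
    ultimately show ?thesis by (simp only:) (simp only: right_diff_distrib mult.assoc add_diff_cancel_left' add_diff_eq)
  qed
  finally show ?case by simp
qed simp

lemma wt_top: "wt (int n) (gE ^ (n + 1))"
  using wt_e_power[OF wt_1, of "n + 1"] by simp

lemma e_top: "\<tau> (a * (gE * gE ^ (n + 1))) = \<tau> 0"
proof -
  have "\<tau> (a * gE ^ (n + 2)) = \<tau> (a * 0)"
    by (intro toT_mult_cong T_generator_toT) simp
  then show ?thesis by simp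
qed

text \<open>The vector \<open>e^(n+1) w\<close> has weight \<open>n\<close> and is killed by
  \<open>e\<close>, so only the scalar term of \<open>ef_power\<close> survives.\<close>

lemma v_e: "\<tau> (gE * (gF ^ i * gE ^ (n + 1))) =
  \<tau> (scal (\<epsilon> * qint q (int i) * qint q (int n - int i + 1)) * (gF ^ (i - 1) * gE ^ (n + 1)))"
proof -
  have *: "int n + 1 - int i = int n - int i + 1" by simp
  have "\<tau> (gE * (gF ^ i * gE ^ (n + 1))) = \<tau> (gF ^ i * (gE * gE ^ (n + 1)) +
      scal (\<epsilon> * qint q (int i) * qint q (int n - int i + 1)) * (gF ^ (i - 1) * gE ^ (n + 1)))"
    using ef_power[OF wt_top, of i] unfolding * .
  also have "\<dots> = \<tau> (0 +
      scal (\<epsilon> * qint q (int i) * qint q (int n - int i + 1)) * (gF ^ (i - 1) * gE ^ (n + 1)))"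
    by (intro toT_add_cong e_top refl)
  finally show ?thesis by simp
qed

section \<open>The vector \<open>z\<close> and the action of \<open>e\<close> on its
  descendants\<close>

lemma wt_fe_power: "wt (- int n - 2) (gF ^ i * gE ^ i)"
  using wt_f_power[OF wt_e_power[OF wt_1, of i], of i] by simp

lemma wt_z: "wt (- int n - 2) (z_elt q n \<epsilon>)"
  unfolding z_elt_def mult.assoc by (intro wt_sum wt_scal wt_fe_power)

text \<open>The vector \<open>e^i w\<close> has weight \<open>2i - n - 2\<close>; there the second
  quantum integer of \<open>ef_power\<close> is \<open>[i - n - 1]\<close>, which explains the minus
  sign.\<close>

lemma e_fe_power:
  "\<tau> (gE * (gF ^ i * gE ^ i)) =
   \<tau> (gF ^ i * gE ^ Suc i - scal (\<epsilon> * qint q (int i) * qint q (int n + 1 - int i)) * (gF ^ (i - 1) * gE ^ i))"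
proof -
  have "wt (- int n - 2 + 2 * int i) (gE ^ i)"
    using wt_e_power[OF wt_1, of i] by simp
  from ef_power[OF this, of i] have "\<tau> (gE * (gF ^ i * gE ^ i)) =
    \<tau> (gF ^ i * (gE * gE ^ i) + scal (\<epsilon> * qint q (int i) * qint q (- int n - 2 + 2 * int i + 1 - int i)) * (gF ^ (i - 1) * gE ^ i))"
    .
  also have "- int n - 2 + 2 * int i + 1 - int i = - (int n + 1 - int i)" by simp
  finally show ?thesis
    by (simp only: qint_minus mult_minus_right scal_uminus mult_minus_left power_Suc) simp
qed

text \<open>The coefficients of \<open>z\<close> satisfy
  \<open>h (i+1) * \<epsilon> [i+1] [n-i] = h i\<close>, so the subtracted term of index
  \<open>i + 1\<close> cancels the leading term of index \<open>i\<close>. The subtracted term of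
  index 0 has the factor \<open>[0]\<close>; what remains is the leading term of index
  \<open>n\<close>, where \<open>h n = 1\<close>.\<close>

lemma z_e: "\<tau> (gE * z_elt q n \<epsilon>) = \<tau> (gF ^ n * gE ^ (n + 1))"
proof -
  define h where "h i = \<epsilon> ^ (n - i) * (qfact q n * qfact q (n - i) / qfact q i)" for i
  define y where "y i = scal (h i) * (gF ^ i * gE ^ Suc i)" for i :: nat
  define y' where "y' i = scal (h i) * (scal (\<epsilon> * qint q (int i) * qint q (int n + 1 - int i)) * (gF ^ (i - 1) * gE ^ i))"
    for i :: nat
  have "gE * z_elt q n \<epsilon> = (\<Sum>i=0..n. scal (h i) * (gE * (gF ^ i * gE ^ i)))"
    unfolding z_elt_def h_def[symmetric] by (simp only: mult.assoc sum_distrib_left scal_left_commute[of gE])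
  also have "\<tau> \<dots> = \<tau> (\<Sum>i=0..n. scal (h i) * (gF ^ i * gE ^ Suc i -
      scal (\<epsilon> * qint q (int i) * qint q (int n + 1 - int i)) * (gF ^ (i - 1) * gE ^ i)))"
    by (intro toT_sum_cong toT_mult_cong e_fe_power)
  also have "(\<Sum>i=0..n. scal (h i) * (gF ^ i * gE ^ Suc i -
      scal (\<epsilon> * qint q (int i) * qint q (int n + 1 - int i)) * (gF ^ (i - 1) * gE ^ i)))
      = (\<Sum>i=0..n. y i) - (\<Sum>i=0..n. y' i)"
    by (simp only: right_diff_distrib y_def y'_def sum_subtractf)
  also have "(\<Sum>i=0..n. y i) = (\<Sum>i<n. y i) + y n"
    by (simp add: atLeast0AtMost lessThan_Suc_atMost[symmetric])
  also have "(\<Sum>i=0..n. y' i) = y' 0 + (\<Sum>i<n. y' (Suc i))"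
    by (simp add: atLeast0AtMost sum.atMost_shift)
  also have "y' 0 = 0" by (simp add: y'_def)
  also have "(\<Sum>i<n. y' (Suc i)) = (\<Sum>i<n. y i)"
  proof (rule sum.cong)
    fix i assume "i \<in> {..<n}"
    then have i: "n - i = Suc (n - Suc i)" "int (n - Suc i) = int n - int i - 1" by auto
    have "h (Suc i) * (\<epsilon> * qint q (int (Suc i)) * qint q (int n + 1 - int (Suc i))) = h i"
      unfolding h_def i(1) by (simp add: qfact_Suc i(2) divide_simps add.commute)
    then show "y' (Suc i) = y i"
      unfolding y_def y'_def scal_mult_left by simp
  qed simp
  also have "y n = gF ^ n * gE ^ (n + 1)"
    by (simp add: y_def h_def qfact_def)
  finally show ?thesis by simp
qed

text \<open>This is \<open>ef_power\<close> at weight \<open>- n - 2\<close>, with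
  \<open>z_e\<close> for the first term. The sign is moved between the two quantum integers so that,
  for index \<open>n + 1 + j\<close>, the coefficient has the form
  \<open>[i][n-i+1]\<close>.\<close>

lemma z_f_e: "\<tau> (gE * (gF ^ j * z_elt q n \<epsilon>)) =
  \<tau> (scal (\<epsilon> * qint q (int n + 1 + int j) * qint q (- int j)) * (gF ^ (j - 1) * z_elt q n \<epsilon>)
     + gF ^ (n + j) * gE ^ (n + 1))"
proof -
  have "\<tau> (gE * (gF ^ j * z_elt q n \<epsilon>)) = \<tau> (gF ^ j * (gE * z_elt q n \<epsilon>) +
      scal (\<epsilon> * qint q (int j) * qint q (- int n - 2 + 1 - int j)) * (gF ^ (j - 1) * z_elt q n \<epsilon>))"
    by (rule ef_power[OF wt_z])
  also have "\<dots> = \<tau> (gF ^ j * (gF ^ n * gE ^ (n + 1)) +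
      scal (\<epsilon> * qint q (int j) * qint q (- int n - 2 + 1 - int j)) * (gF ^ (j - 1) * z_elt q n \<epsilon>))"
    by (intro toT_add_cong toT_mult_cong z_e refl)
  also have "gF ^ j * (gF ^ n * gE ^ (n + 1)) = gF ^ (n + j) * gE ^ (n + 1)"
    by (simp only: power_add[symmetric] mult.assoc[symmetric] add.commute)
  also have "- int n - 2 + 1 - int j = - (int n + 1 + int j)" by simp
  also have "\<epsilon> * qint q (int j) * qint q (- (int n + 1 + int j)) = \<epsilon> * qint q (int n + 1 + int j) * qint q (- int j)"
    unfolding qint_minus by simp
  finally show ?thesis by (simp only: add.commute)
qed

end

section \<open>A model of the T module\<close>

context T_parameters
begin

text \<open>The vector with index \<open>Inl i\<close> stands for \<open>v\<^sub>i\<close>, that with index \<open>Inr j\<close> for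
  \<open>z\<^sub>n\<^sub>+\<^sub>1\<^sub>+\<^sub>j\<close>. Arbitrary functions are allowed as coordinates, since each coordinate of an
  image depends on finitely many coordinates of the argument.\<close>

primrec model_gen :: "gen \<Rightarrow> (nat + nat \<Rightarrow> 'k) \<Rightarrow> nat + nat \<Rightarrow> 'k" where
  "model_gen Gen_e x = case_sum
    (\<lambda>i. \<epsilon> * qint q (int i + 1) * qint q (int n - int i) * x (Inl (i + 1)) +
         (if i < n then 0 else x (Inr (i - n))))
    (\<lambda>j. \<epsilon> * qint q (int n + int j + 2) * qint q (- int j - 1) * x (Inr (j + 1)))"
| "model_gen Gen_f x = case_sum
    (\<lambda>i. if i = 0 then 0 else x (Inl (i - 1)))
    (\<lambda>j. if j = 0 then 0 else x (Inr (j - 1)))"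
| "model_gen Gen_t x = case_sum
    (\<lambda>i. \<epsilon> * q powi (int n - 2 * int i) * x (Inl i))
    (\<lambda>j. \<epsilon> * q powi (- int n - 2 - 2 * int j) * x (Inr j))"
| "model_gen Gen_tinv x = case_sum
    (\<lambda>i. \<epsilon> * q powi (2 * int i - int n) * x (Inl i))
    (\<lambda>j. \<epsilon> * q powi (int n + 2 + 2 * int j) * x (Inr j))"

sublocale model: gen_operators "\<lambda>c x s. c * x s" model_gen
proof
  fix a c and x y :: "nat + nat \<Rightarrow> 'k"
  show "model_gen a (x + y) = model_gen a x + model_gen a y"
    by (cases a) (auto simp: fun_eq_iff algebra_simps split: sum.split)
  show "model_gen a (\<lambda>s. c * x s) = (\<lambda>s. c * model_gen a x s)"
    by (cases a) (auto simp: fun_eq_iff algebra_simps split: sum.split)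
qed (auto simp: fun_eq_iff algebra_simps)

lemma model_gen_zero [simp]: "model_gen a (\<lambda>s. 0) = (\<lambda>s. 0)"
  using model.g_zero[of a] by (simp only: zero_fun_def)

section \<open>The relations of \<open>U_q\<close> in the model\<close>

lemma weight_commutator:
  "m' = - m \<Longrightarrow> (\<epsilon> * q powi m * y - \<epsilon> * q powi m' * y) / (q - inverse q) = \<epsilon> * qint q m * y"
  by (simp add: qint_def algebra_simps diff_divide_distrib)

text \<open>In both halves of the index set the commutator is a difference of two products of
  quantum integers, evaluated by \<open>qint_mult_diff\<close>.\<close>

lemma model_ef:
  "model_gen Gen_e (model_gen Gen_f x) s - model_gen Gen_f (model_gen Gen_e x) s =
    (model_gen Gen_t x s - model_gen Gen_tinv x s) / (q - inverse q)"
proof (cases s)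
  case (Inl i)
  have "model_gen Gen_e (model_gen Gen_f x) s - model_gen Gen_f (model_gen Gen_e x) s
      = \<epsilon> * qint q (int n - 2 * int i) * x (Inl i)"
  proof (cases i)
    case 0
    then show ?thesis using Inl qint_mult_diff[of 0 "int n"] by simp
  next
    case (Suc k)
    have "model_gen Gen_e (model_gen Gen_f x) s - model_gen Gen_f (model_gen Gen_e x) s
      = \<epsilon> * (qint q (int k + 1 + 1) * qint q (int n - int k - 1)
          - qint q (int k + 1) * qint q (int n - int k - 1 + 1)) * x (Inl i)"
      \<comment> \<open>The contributions of \<open>z\<close> coordinates to both products agree,
        since \<open>f\<close> shifts both halves alike, and cancel.\<close>
      using Inl Suc by (auto simp: algebra_simps Suc_diff_le)
    then show ?thesis
      using Suc unfolding qint_mult_diff by (simp add: algebra_simps)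
  qed
  then show ?thesis
    using Inl weight_commutator[of "2 * int i - int n" "int n - 2 * int i" "x (Inl i)"] by simp
next
  case (Inr j)
  have "model_gen Gen_e (model_gen Gen_f x) s - model_gen Gen_f (model_gen Gen_e x) s
      = \<epsilon> * (qint q (int n + int j + 1 + 1) * qint q (- int j - 1)
          - qint q (int n + int j + 1) * qint q (- int j - 1 + 1)) * x (Inr j)"
  \<comment> \<open>At \<open>j = 0\<close> the factor \<open>[0]\<close> matches the fact that
    \<open>f\<close> produces nothing in the coordinate \<open>Inr 0\<close>.\<close>
  proof (cases j)
    case 0
    then show ?thesis using Inr by (simp add: add.commute)
  next
    case (Suc k)
    then have *: "- int j - 1 + 1 = - int k - 1" "int n + int j + 1 = int n + int k + 2" by simp_all
    show ?thesis
      unfolding * using Inr Suc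
      by (simp add: left_diff_distrib right_diff_distrib mult.assoc add_ac)
  qed
  also have "\<dots> = \<epsilon> * qint q (- int n - 2 - 2 * int j) * x (Inr j)"
    unfolding qint_mult_diff by (simp add: algebra_simps)
  finally show ?thesis
    using Inr weight_commutator[of "int n + 2 + 2 * int j" "- int n - 2 - 2 * int j" "x (Inr j)"]
    by simp
qed

lemma powi_mult: "q powi a * q powi b = q powi (a + b)"
  using q_nz by (simp add: power_int_add)

lemma weight_conj:
  "\<epsilon> * q powi a * (\<epsilon> * q powi b * x) = q powi (a + b) * x"
  "\<epsilon> * q powi a * (u * (\<epsilon> * q powi b * x)) = q powi (a + b) * (u * x)"
  by (simp_all add: power_int_add q_nz mult_ac)

lemma Uq_relations_model:
  assumes "r \<in> Uq_relations q"
  shows "model.act r = (\<lambda>x. 0)"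
proof -
  have 1: "model_gen Gen_t (model_gen Gen_tinv x) s = x s"
    "model_gen Gen_tinv (model_gen Gen_t x) s = x s" for x s
    by (cases s; simp add: weight_conj)+
  have 2: "model_gen Gen_t (model_gen Gen_e (model_gen Gen_tinv x)) s
      = q powi 2 * model_gen Gen_e x s" for x s
  proof (cases s)
    case (Inl i)
    let ?u = "\<epsilon> * qint q (int i + 1) * qint q (int n - int i)"
    have 1: "\<epsilon> * q powi (int n - 2 * int i) * (?u * (\<epsilon> * q powi (2 * int (i + 1) - int n) * x (Inl (i + 1))))
        = q powi 2 * (?u * x (Inl (i + 1)))"
      by (simp add: weight_conj)
    \<comment> \<open>For \<open>i \<ge> n\<close> the subtraction \<open>i - n\<close> is exact,
      and the term that feeds \<open>z\<close> into \<open>v\<close> also raises the weight by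
      2.\<close>
    have 2: "\<epsilon> * q powi (int n - 2 * int i) * (\<epsilon> * q powi (int n + 2 + 2 * int (i - n)) * x (Inr (i - n)))
        = q powi 2 * x (Inr (i - n))" if "\<not> i < n"
      using that by (simp add: weight_conj of_nat_diff)
    show ?thesis
      by (cases "i < n") (simp_all only: Inl model_gen.simps sum.case if_True if_False distrib_left 1 2
          add_0_right mult_zero_right not_False_eq_True)
  next
    case (Inr j)
    then show ?thesis by (simp add: weight_conj)
  qed
  have 3: "model_gen Gen_t (model_gen Gen_f (model_gen Gen_tinv x)) s
      = q powi (- 2) * model_gen Gen_f x s" for x s
    by (cases s) (auto simp: weight_conj of_nat_diff)
  have "model.act r x s = 0" for x s
    using assms unfolding Uq_relations_def
    by (auto simp: model.act_simps 1 2 3 model_ef simp del: model_gen.simps)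
  then show ?thesis by (intro ext) simp
qed

lemma Uq_ideal_model: "p \<in> Uq_ideal q \<Longrightarrow> model.act p = (\<lambda>x. 0)"
  using ring.genideal_minimal[OF class_ring.ring_axioms model.ideal_act_ker, of "Uq_relations q"]
    Uq_relations_model unfolding Uq_ideal_def by auto

section \<open>Basis vectors of the model\<close>

abbreviation \<delta> :: "nat + nat \<Rightarrow> nat + nat \<Rightarrow> 'k" where
  "\<delta> s \<equiv> (\<lambda>s'. if s' = s then 1 else 0)"

lemma model_f_\<delta> [simp]:
  "model_gen Gen_f (\<delta> (Inl i)) = \<delta> (Inl (Suc i))" "model_gen Gen_f (\<delta> (Inr i)) = \<delta> (Inr (Suc i))"
  by (auto simp: fun_eq_iff split: sum.split)

lemma model_t_\<delta> [simp]:
  "model_gen Gen_t (\<delta> (Inl i)) = (\<lambda>s. \<epsilon> * q powi (int n - 2 * int i) * \<delta> (Inl i) s)"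
  "model_gen Gen_t (\<delta> (Inr i)) = (\<lambda>s. \<epsilon> * q powi (- int n - 2 - 2 * int i) * \<delta> (Inr i) s)"
  "model_gen Gen_tinv (\<delta> (Inl i)) = (\<lambda>s. \<epsilon> * q powi (2 * int i - int n) * \<delta> (Inl i) s)"
  "model_gen Gen_tinv (\<delta> (Inr i)) = (\<lambda>s. \<epsilon> * q powi (int n + 2 + 2 * int i) * \<delta> (Inr i) s)"
  by (auto simp: fun_eq_iff split: sum.split)

text \<open>The last equation, \<open>e z_{n+1} = v_n\<close>, links the two halves of the
  model.\<close>

lemma model_e_\<delta> [simp]:
  "model_gen Gen_e (\<delta> (Inl 0)) = 0"
  "model_gen Gen_e (\<delta> (Inl (Suc i))) =
    (\<lambda>s. \<epsilon> * qint q (int i + 1) * qint q (int n - int i) * \<delta> (Inl i) s)"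
  "model_gen Gen_e (\<delta> (Inr 0)) = \<delta> (Inl n)"
  by (auto simp: fun_eq_iff split: sum.split)

declare model_gen.simps [simp del]

lemma act_f_power_\<delta>:
  "model.act (gF ^ j) (\<delta> (Inl i)) = \<delta> (Inl (i + j))" "model.act (gF ^ j) (\<delta> (Inr i)) = \<delta> (Inr (i + j))"
  by (induction j) (simp_all add: model.act_mult)

text \<open>The scalar is a product of factors \<open>\<epsilon> [l+1][n-l]\<close> with
  \<open>l < i\<close>; for \<open>i \<le> n\<close> none of them vanishes.\<close>

lemma act_e_power_\<delta>:
  "k \<le> i \<Longrightarrow> \<exists>c. model.act (gE ^ k) (\<delta> (Inl i)) = (\<lambda>s. c * \<delta> (Inl (i - k)) s) \<and> (i \<le> n \<longrightarrow> c \<noteq> 0)"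
proof (induction k)
  case 0
  show ?case by (intro exI[of _ 1]) simp
next
  case (Suc k)
  then obtain c where c: "model.act (gE ^ k) (\<delta> (Inl i)) = (\<lambda>s. c * \<delta> (Inl (i - k)) s)"
    "i \<le> n \<longrightarrow> c \<noteq> 0" by auto
  obtain l where l: "i - k = Suc l" "i - Suc k = l" using Suc.prems by (metis Suc_diff_Suc Suc_le_lessD)
  have "model.act (gE ^ Suc k) (\<delta> (Inl i)) = model_gen Gen_e (\<lambda>s. c * \<delta> (Inl (i - k)) s)"
    by (simp add: model.act_mult c)
  also have "\<dots> = (\<lambda>s. c * (\<epsilon> * qint q (int l + 1) * qint q (int n - int l)) * \<delta> (Inl l) s)"
    by (simp only: l model.g_scale model_e_\<delta> mult.assoc)
  finally show ?case using c(2) l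
    by (intro exI[of _ "c * (\<epsilon> * qint q (int l + 1) * qint q (int n - int l))"]) auto
qed

lemma act_e_power_Suc_\<delta>: "model.act (gE ^ Suc k) (\<delta> (Inr 0)) = model.act (gE ^ k) (\<delta> (Inl n))"
  by (simp add: model.act_mult power_Suc2 del: power_Suc)

text \<open>Up to the sign \<open>\<epsilon>\<close>, the right-hand side is the value of the
  \<open>t\<close> part of the Casimir element at weight \<open>- n - 2\<close>. Subtracting it
  leaves just \<open>f e\<close> on that weight, both in the model and in the T module.\<close>

lemma cas_val_eq:
  "cas_val q n = 1 / (q - inverse q)\<^sup>2 * (q * q powi (- int n - 2) + inverse q * q powi (int n + 2))"
proof -
  have *: "- int n - 1 = 1 + (- int n - 2)" "int n + 1 = - 1 + (int n + 2)" by simp_all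
  have "q powi (- int n - 1) = q * q powi (- int n - 2)" "q powi (int n + 1) = inverse q * q powi (int n + 2)"
    unfolding * powi_mult[symmetric] by (simp_all add: power_int_minus)
  then show ?thesis by (simp add: cas_val_def add.commute)
qed

text \<open>The operator \<open>C - \<epsilon> c\<close> sends \<open>z_{n+1}\<close> to
  \<open>f v_n = v_{n+1}\<close>, which has the same weight and is killed by \<open>e\<close>
  because of the factor \<open>[0]\<close>. Moreover \<open>e^(n+2) z_{n+1} = e^(n+1) v_n\<close>,
  and \<open>e^n v_n\<close> is a multiple of \<open>v_0\<close>.\<close>

lemma T_generators_model:
  assumes "p \<in> {gT - scal (\<epsilon> * q powi (- int n - 2)), gE ^ (n + 2),
      (casimir q - scal (\<epsilon> * cas_val q n))\<^sup>2}"
  shows "model.act p (\<delta> (Inr 0)) = 0"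
proof -
  let ?D = "casimir q - scal (\<epsilon> * cas_val q n)"
  have D: "model.act ?D x = model_gen Gen_f (model_gen Gen_e x)"
    if t: "model_gen Gen_t x = (\<lambda>s. \<epsilon> * q powi (- int n - 2) * x s)"
      "model_gen Gen_tinv x = (\<lambda>s. \<epsilon> * q powi (int n + 2) * x s)" for x
  proof
    fix s
    have *: "d * (q * (\<epsilon> * a * y) + inverse q * (\<epsilon> * b * y)) + w
        - \<epsilon> * (d * (q * a + inverse q * b)) * y = w" for d a b y w
      by (simp add: distrib_left distrib_right mult_ac)
    show "model.act ?D x s = model_gen Gen_f (model_gen Gen_e x) s"
      by (simp only: casimir_def model.act_add_left model.act_mult model.act_diff model.act_scal
          model.act_gens plus_fun_apply minus_apply t cas_val_eq *)
  qed
  have 1: "model.act ?D (\<delta> (Inr 0)) = \<delta> (Inl (Suc n))"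
    by (subst D) simp_all
  have 2: "model.act ?D (\<delta> (Inl (Suc n))) = 0"
    by (subst D) (simp_all add: fun_eq_iff)
  have "model.act (gE ^ (n + 2)) (\<delta> (Inr 0)) = 0"
  proof -
    obtain c where "model.act (gE ^ n) (\<delta> (Inl n)) = (\<lambda>s. c * \<delta> (Inl 0) s)"
      using act_e_power_\<delta>[of n n] by auto
    then have "model.act (gE * gE ^ n) (\<delta> (Inl n)) = (\<lambda>s. c * 0)"
      by (simp only: model.act_mult model.act_gens model.g_scale) simp
    then show ?thesis using act_e_power_Suc_\<delta>[of "Suc n"] by (simp add: zero_fun_def)
  qed
  moreover have "model.act (?D\<^sup>2) (\<delta> (Inr 0)) = 0"
    unfolding power2_eq_square model.act_mult 1 2 ..
  moreover have "model.act (gT - scal (\<epsilon> * q powi (- int n - 2))) (\<delta> (Inr 0)) = 0"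
    by (simp add: fun_eq_iff model.act_diff)
  ultimately show ?thesis using assms by blast
qed

section \<open>The induced map from the T module to the model\<close>

lemma left_ideal_model: "left_ideal {toU q p |p. model.act p x = 0} (Uq q)"
proof -
  interpret ring "Uq q" by (rule ring_Uq)
  let ?I = "{toU q p |p. model.act p x = 0}"
  have "subgroup ?I (add_monoid (Uq q))"
  proof (rule add.subgroupI)
    show "?I \<noteq> {}" by (auto intro: exI[of _ 0])
    show "\<ominus>\<^bsub>Uq q\<^esub> a \<in> ?I" if "a \<in> ?I" for a
    proof -
      obtain p where "a = toU q p" "model.act p x = 0" using \<open>a \<in> ?I\<close> by blast
      then have "\<ominus>\<^bsub>Uq q\<^esub> a = toU q (- p)" "model.act (- p) x = 0"
        by (simp_all add: toU_uminus model.act_uminus)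
      then show ?thesis by blast
    qed
    show "a \<oplus>\<^bsub>Uq q\<^esub> b \<in> ?I" if "a \<in> ?I" "b \<in> ?I" for a b
    proof -
      obtain p r where "a = toU q p" "model.act p x = 0" "b = toU q r" "model.act r x = 0"
        using \<open>a \<in> ?I\<close> \<open>b \<in> ?I\<close> by blast
      then have "a \<oplus>\<^bsub>Uq q\<^esub> b = toU q (p + r)" "model.act (p + r) x = 0"
        by (simp_all add: toU_add model.act_add_left)
      then show ?thesis by blast
    qed
  qed (auto simp: toU_carrier)
  moreover have "b \<otimes>\<^bsub>Uq q\<^esub> a \<in> ?I" if "a \<in> ?I" "b \<in> carrier (Uq q)" for a b
  proof -
    obtain p r where "a = toU q p" "model.act p x = 0" "b = toU q r"
      using \<open>a \<in> ?I\<close> \<open>b \<in> carrier (Uq q)\<close> unfolding carrier_Uq by blast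
    then have "b \<otimes>\<^bsub>Uq q\<^esub> a = toU q (r * p)" "model.act (r * p) x = 0"
      by (simp_all add: toU_mult model.act_mult)
    then show ?thesis by blast
  qed
  ultimately show ?thesis
    by (intro left_ideal.intro left_ideal_axioms.intro additive_subgroup.intro ring_axioms)
qed

text \<open>Minimality of \<open>T_ideal\<close> only provides some representative \<open>r\<close>
  of the same coset that kills \<open>z_{n+1}\<close>; \<open>p - r\<close> lies in
  \<open>Uq_ideal\<close> and acts as zero, so \<open>p\<close> kills it too.\<close>

lemma act_eq_0_of_T_ideal:
  assumes "toU q p \<in> T_ideal q n \<epsilon>"
  shows "model.act p (\<delta> (Inr 0)) = 0"
proof -
  let ?I = "{toU q p |p. model.act p (\<delta> (Inr 0)) = 0}"
  have "T_ideal q n \<epsilon> \<subseteq> ?I"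
    unfolding T_ideal_def gen_left_ideal_def
    using left_ideal_model[of "\<delta> (Inr 0)"] T_generators_model by blast
  then obtain r where r: "toU q p = toU q r" "model.act r (\<delta> (Inr 0)) = 0"
    using assms by auto
  then have "model.act (p - r) = (\<lambda>x. 0)"
    by (intro Uq_ideal_model) (simp add: toU_eq_iff)
  then show ?thesis using r(2) by (simp add: model.act_diff fun_eq_iff)
qed

lemma act_eq_of_toT_eq:
  "toT q n \<epsilon> p = toT q n \<epsilon> r \<Longrightarrow> model.act p (\<delta> (Inr 0)) = model.act r (\<delta> (Inr 0))"
  using act_eq_0_of_T_ideal[of "p - r"] by (simp add: toT_eq_iff model.act_diff)

text \<open>\<open>e^(n+1)\<close> takes \<open>z_{n+1}\<close> through \<open>v_n\<close> to a
  nonzero multiple of \<open>v_0\<close>. Applying \<open>f^i\<close> afterwards merely shifts the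
  index, so one constant serves all \<open>i\<close>.\<close>

lemma act_v:
  "\<exists>c. c \<noteq> 0 \<and> (\<forall>i. model.act (gF ^ i * gE ^ (n + 1)) (\<delta> (Inr 0)) = (\<lambda>s. c * \<delta> (Inl i) s))"
proof -
  obtain c where c: "model.act (gE ^ n) (\<delta> (Inl n)) = (\<lambda>s. c * \<delta> (Inl 0) s)" "c \<noteq> 0"
    using act_e_power_\<delta>[of n n] by auto
  have "model.act (gF ^ i * gE ^ (n + 1)) (\<delta> (Inr 0)) = (\<lambda>s. c * \<delta> (Inl i) s)" for i
    using act_e_power_Suc_\<delta>[of n]
    by (simp only: model.act_mult c Suc_eq_plus1 model.act_scale act_f_power_\<delta> add_0)
  with c(2) show ?thesis by blast
qed

lemma sum_apply: "(\<Sum>i\<in>A. h i) x = (\<Sum>i\<in>A. h i x)" for h :: "'i \<Rightarrow> 's \<Rightarrow> 'v::comm_monoid_add"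
  by (induction A rule: infinite_finite_induct) simp_all

text \<open>For \<open>1 \<le> i \<le> n\<close> the vector
  \<open>f^i e^i z_{n+1} = f^i e^(i-1) v_n\<close> is a multiple of \<open>v_{n+1}\<close>. The
  summand \<open>i = 0\<close> contributes \<open>h 0\<close> times \<open>z_{n+1}\<close>, and
  \<open>h 0\<close> is nonzero.\<close>

lemma act_z:
  "\<exists>a b. a \<noteq> 0 \<and> (\<forall>j. model.act (gF ^ j * z_elt q n \<epsilon>) (\<delta> (Inr 0)) =
      (\<lambda>s. a * \<delta> (Inr j) s + b * \<delta> (Inl (n + 1 + j)) s))"
proof -
  have "\<exists>c. model.act (gF ^ i * gE ^ i) (\<delta> (Inr 0)) = (\<lambda>s. c * \<delta> (Inl (n + 1)) s)"
    if i: "i \<in> {1..n}" for i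
  proof -
    obtain k where k: "i = Suc k" using i by (cases i) auto
    then obtain c where "model.act (gE ^ k) (\<delta> (Inl n)) = (\<lambda>s. c * \<delta> (Inl (n - k)) s)"
      using act_e_power_\<delta>[of k n] i by auto
    then have "model.act (gF ^ i * gE ^ i) (\<delta> (Inr 0)) = (\<lambda>s. c * \<delta> (Inl (n - k + i)) s)"
      unfolding k by (simp only: model.act_mult act_e_power_Suc_\<delta> model.act_scale act_f_power_\<delta>)
    moreover have "n - k + i = n + 1" using i k by auto
    ultimately show ?thesis by auto
  qed
  then obtain c where c: "\<And>i. i \<in> {1..n} \<Longrightarrow>
      model.act (gF ^ i * gE ^ i) (\<delta> (Inr 0)) = (\<lambda>s. c i * \<delta> (Inl (n + 1)) s)"
    by metis
  define h where "h i = \<epsilon> ^ (n - i) * (qfact q n * qfact q (n - i) / qfact q i)" for i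
  have "model.act (z_elt q n \<epsilon>) (\<delta> (Inr 0)) s
      = h 0 * \<delta> (Inr 0) s + (\<Sum>i=1..n. h i * c i) * \<delta> (Inl (n + 1)) s" for s
  proof -
    have "model.act (z_elt q n \<epsilon>) (\<delta> (Inr 0)) s
      = (\<Sum>i=0..n. h i * model.act (gF ^ i * gE ^ i) (\<delta> (Inr 0)) s)"
      unfolding z_elt_def h_def[symmetric] mult.assoc
      by (simp only: model.act_sum model.act_mult[of "scal _"] model.act_scal sum_apply)
    also have "\<dots> = h 0 * model.act (gF ^ 0 * gE ^ 0) (\<delta> (Inr 0)) s
        + (\<Sum>i=1..n. h i * model.act (gF ^ i * gE ^ i) (\<delta> (Inr 0)) s)"
      by (subst sum.atLeast_Suc_atMost) simp_all
    also have "(\<Sum>i=1..n. h i * model.act (gF ^ i * gE ^ i) (\<delta> (Inr 0)) s)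
        = (\<Sum>i=1..n. h i * c i) * \<delta> (Inl (n + 1)) s"
      unfolding sum_distrib_right by (rule sum.cong) (simp_all only: c mult.assoc)
    finally show ?thesis by simp
  qed
  then have "model.act (z_elt q n \<epsilon>) (\<delta> (Inr 0))
      = (\<lambda>s. h 0 * \<delta> (Inr 0) s) + (\<lambda>s. (\<Sum>i=1..n. h i * c i) * \<delta> (Inl (n + 1)) s)"
    by (intro ext) (simp only: plus_fun_apply)
  then have "model.act (gF ^ j * z_elt q n \<epsilon>) (\<delta> (Inr 0)) =
      (\<lambda>s. h 0 * \<delta> (Inr j) s) + (\<lambda>s. (\<Sum>i=1..n. h i * c i) * \<delta> (Inl (n + 1 + j)) s)" for j
    by (simp only: model.act_mult model.act_add model.act_scale act_f_power_\<delta> add_0)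
  moreover have "h 0 \<noteq> 0" by (simp add: h_def)
  ultimately show ?thesis by (intro exI[of _ "h 0"] exI[of _ "\<Sum>i=1..n. h i * c i"]) (auto simp: fun_eq_iff)
qed

end

section \<open>Structure of the T module\<close>

context T_parameters
begin

section \<open>Nilpotency of \<open>f e\<close> and the recovery of \<open>w\<close> from
  \<open>z\<close>\<close>

lemma casimir_fe:
  assumes "wt (- int n - 2) x"
  shows "\<tau> ((casimir q - scal (\<epsilon> * cas_val q n)) * x) = \<tau> (gF * (gE * x))"
proof -
  define d where "d = 1 / (q - inverse q)\<^sup>2"
  let ?a = "\<epsilon> * q powi (- int n - 2)" and ?b = "\<epsilon> * q powi (- (- int n - 2))"
  have "(casimir q - scal (\<epsilon> * cas_val q n)) * x = scal d * (scal q * (gT * x) + scal (inverse q) * (gTinv * x))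
      + gF * (gE * x) - scal (\<epsilon> * cas_val q n) * x"
    by (simp only: casimir_def d_def left_diff_distrib distrib_right distrib_left mult.assoc)
  also have "\<tau> \<dots> = \<tau> (scal d * (scal q * (scal ?a * x) + scal (inverse q) * (scal ?b * x))
      + gF * (gE * x) - scal (\<epsilon> * cas_val q n) * x)"
    using assms by (intro toT_diff_cong toT_add_cong toT_mult_cong wt_tinv refl) (simp_all only: wt_def)
  also have "scal d * (scal q * (scal ?a * x) + scal (inverse q) * (scal ?b * x))
      = scal (d * (q * ?a + inverse q * ?b)) * x"
    by (simp only: scal_mult_left scal_add distrib_right[symmetric])
  also have "d * (q * ?a + inverse q * ?b) = \<epsilon> * cas_val q n"
  proof -
    have *: "- (- int n - 2) = int n + 2" by simp
    show ?thesis unfolding * cas_val_eq d_def by (simp only: distrib_left mult_ac)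
  qed
  finally show ?thesis by simp
qed

text \<open>Both \<open>w\<close> and \<open>f e w\<close> have weight \<open>- n - 2\<close>, so
  \<open>casimir_fe\<close> can be applied twice to the squared generator of
  \<open>T_ideal\<close>.\<close>

lemma fefe: "\<tau> (gF * (gE * (gF * gE))) = \<tau> 0"
proof -
  let ?D = "casimir q - scal (\<epsilon> * cas_val q n)"
  have fe: "wt (- int n - 2) (gF * gE)"
    using wt_fe_power[of 1] by simp
  have "\<tau> (?D * 1) = \<tau> (gF * gE)"
    using casimir_fe[OF wt_1] by simp
  then have "\<tau> (?D * ?D) = \<tau> (?D * (gF * gE))"
    using toT_mult_cong[of q n \<epsilon> "?D" "gF * gE" ?D] by simp
  also have "\<dots> = \<tau> (gF * (gE * (gF * gE)))"
    by (rule casimir_fe[OF fe])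
  finally show ?thesis
    using T_generator_toT[of "?D\<^sup>2"] by (simp add: power2_eq_square)
qed

text \<open>Multiplying \<open>e_fe_power\<close> by \<open>f\<close> and using \<open>fefe\<close>
  gives \<open>f^(i+1) e^(i+1) w = \<epsilon> [i][n+1-i] f^i e^i w\<close> for
  \<open>i \<ge> 1\<close>, with nonzero factor as long as \<open>i \<le> n\<close>.\<close>

lemma fe_power_Suc:
  "\<exists>c. \<tau> (gF ^ Suc i * gE ^ Suc i) = \<tau> (scal c * (gF * gE)) \<and> (i \<le> n \<longrightarrow> c \<noteq> 0)"
proof (induction i)
  case 0
  show ?case by (intro exI[of _ 1]) simp
next
  case (Suc i)
  let ?y = "\<lambda>i. gF ^ i * gE ^ i"
  let ?a = "\<epsilon> * qint q (int (Suc i)) * qint q (int n + 1 - int (Suc i))"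
  obtain c where c: "\<tau> (?y (Suc i)) = \<tau> (scal c * (gF * gE))" "i \<le> n \<longrightarrow> c \<noteq> 0"
    using Suc by blast
  have "\<tau> (gF * (gE * ?y (Suc i))) = \<tau> (gF * (gF ^ Suc i * gE ^ Suc (Suc i) - scal ?a * (gF ^ (Suc i - 1) * gE ^ Suc i)))"
    by (rule toT_mult_cong[OF e_fe_power])
  also have "gF * (gF ^ Suc i * gE ^ Suc (Suc i) - scal ?a * (gF ^ (Suc i - 1) * gE ^ Suc i))
      = ?y (Suc (Suc i)) - scal ?a * ?y (Suc i)"
    by (simp add: right_diff_distrib scal_left_commute[of gF] mult.assoc)
  finally have "\<tau> (?y (Suc (Suc i)) - scal ?a * ?y (Suc i) + scal ?a * ?y (Suc i))
      = \<tau> (gF * (gE * ?y (Suc i)) + scal ?a * ?y (Suc i))"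
    by (intro toT_add_cong) simp_all
  also have "\<dots> = \<tau> (gF * (gE * (scal c * (gF * gE))) + scal ?a * (scal c * (gF * gE)))"
    by (intro toT_add_cong toT_mult_cong c)
  also have "gF * (gE * (scal c * (gF * gE))) = scal c * (gF * (gE * (gF * gE)))"
    by (simp only: scal_left_commute[of gE] scal_left_commute[of gF])
  also have "\<tau> (\<dots> + scal ?a * (scal c * (gF * gE))) = \<tau> (scal c * 0 + scal ?a * (scal c * (gF * gE)))"
    by (intro toT_add_cong toT_mult_cong fefe refl)
  finally have "\<tau> (?y (Suc (Suc i))) = \<tau> (scal (?a * c) * (gF * gE))"
    by (simp only: diff_add_cancel mult_zero_right add_0 scal_mult_left)
  moreover have "Suc i \<le> n \<longrightarrow> ?a * c \<noteq> 0"
    using c(2) by auto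
  ultimately show ?case by blast
qed

text \<open>In \<open>T\<close> one has \<open>z = h 0 w + s f e w\<close> and
  \<open>f^(n+1) e^(n+1) w = d f e w\<close>. As \<open>h 0\<close> and \<open>d\<close> are
  nonzero, this can be solved for \<open>w\<close>.\<close>

lemma one_toT:
  "\<exists>a b. \<tau> 1 = \<tau> (scal a * z_elt q n \<epsilon> + scal b * (gF ^ (n + 1) * gE ^ (n + 1)))"
proof -
  have "\<exists>c. \<tau> (gF ^ i * gE ^ i) = \<tau> (scal c * (gF * gE))" if i: "i \<in> {1..n}" for i
  proof -
    obtain k where "i = Suc k" using i by (cases i) auto
    then show ?thesis using fe_power_Suc[of k] by blast
  qed
  then obtain c where c: "\<And>i. i \<in> {1..n} \<Longrightarrow> \<tau> (gF ^ i * gE ^ i) = \<tau> (scal (c i) * (gF * gE))"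
    by metis
  obtain d where d: "\<tau> (gF ^ Suc n * gE ^ Suc n) = \<tau> (scal d * (gF * gE))" "d \<noteq> 0"
    using fe_power_Suc[of n] by auto
  define h where "h i = \<epsilon> ^ (n - i) * (qfact q n * qfact q (n - i) / qfact q i)" for i
  define s where "s = (\<Sum>i=1..n. h i * c i)"
  have h0: "h 0 \<noteq> 0" by (simp add: h_def)
  have "z_elt q n \<epsilon> = (\<Sum>i=0..n. scal (h i) * (gF ^ i * gE ^ i))"
    unfolding z_elt_def h_def[symmetric] by (simp only: mult.assoc)
  also have "\<dots> = scal (h 0) + (\<Sum>i=1..n. scal (h i) * (gF ^ i * gE ^ i))"
    by (subst sum.atLeast_Suc_atMost) simp_all
  also have "\<tau> \<dots> = \<tau> (scal (h 0) + (\<Sum>i=1..n. scal (h i) * (scal (c i) * (gF * gE))))"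
    by (intro toT_add_cong toT_sum_cong toT_mult_cong c refl)
  also have "(\<Sum>i=1..n. scal (h i) * (scal (c i) * (gF * gE))) = scal s * (gF * gE)"
    by (simp only: s_def scal_mult_left scal_sum sum_distrib_right)
  finally have z: "\<tau> (z_elt q n \<epsilon>) = \<tau> (scal (h 0) + scal s * (gF * gE))" .
  \<comment> \<open>Chosen to cancel the multiple of \<open>f e w\<close> left after dividing
    \<open>z\<close> by \<open>h 0\<close>.\<close>
  let ?b = "- (s / (h 0 * d))"
  have "\<tau> (scal (1 / h 0) * z_elt q n \<epsilon> + scal ?b * (gF ^ Suc n * gE ^ Suc n))
      = \<tau> (scal (1 / h 0) * (scal (h 0) + scal s * (gF * gE)) + scal ?b * (scal d * (gF * gE)))"
    by (intro toT_add_cong toT_mult_cong z d)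
  also have "scal (1 / h 0) * (scal (h 0) + scal s * (gF * gE)) + scal ?b * (scal d * (gF * gE))
      = scal (1 / h 0 * h 0) + scal (1 / h 0 * s + ?b * d) * (gF * gE)"
    by (simp only: distrib_left scal_mult scal_mult_left distrib_right scal_add[symmetric] add.assoc)
  also have "1 / h 0 * h 0 = 1" using h0 by simp
  also have "1 / h 0 * s + ?b * d = 0" using h0 d(2) by simp
  finally show ?thesis by (metis Suc_eq_plus1 add.right_neutral mult_zero_left scal_0 scal_1)
qed

section \<open>The action on the vectors \<open>v_i\<close> and \<open>z_i\<close>\<close>

abbreviation TM :: "('k free_alg set, 'k free_alg set set) module" where
  "TM \<equiv> T_mod q n \<epsilon>"

abbreviation fam :: "nat + nat \<Rightarrow> 'k free_alg set set" where
  "fam \<equiv> case_sum (v_vec q n \<epsilon>) (\<lambda>i. z_vec q n \<epsilon> (n + 1 + i))"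

lemma z_vec_eq: "z_vec q n \<epsilon> (n + 1 + j) = \<tau> (gF ^ j * z_elt q n \<epsilon>)"
  by (simp add: z_vec_def)

lemma v_vec_carrier: "v_vec q n \<epsilon> i \<in> carrier TM" and z_vec_carrier: "z_vec q n \<epsilon> i \<in> carrier TM"
  by (simp_all add: v_vec_def z_vec_def zero_toT)

sublocale TM: left_module "Uq q" TM
  by (rule left_module_T_mod)

sublocale TV: vectorspace class_ring "vsp q TM"
  by (rule vectorspace_vsp[OF left_module_T_mod])

lemma v_vec_t: "toU q gT \<odot>\<^bsub>TM\<^esub> v_vec q n \<epsilon> i
    = (\<epsilon> * q powi (int n - 2 * int i)) \<odot>\<^bsub>vsp q TM\<^esub> v_vec q n \<epsilon> i"
  and v_vec_tinv: "toU q gTinv \<odot>\<^bsub>TM\<^esub> v_vec q n \<epsilon> i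
    = (\<epsilon> * q powi (- (int n - 2 * int i))) \<odot>\<^bsub>vsp q TM\<^esub> v_vec q n \<epsilon> i"
  using wt_f_power[OF wt_top, of i] wt_tinv[OF wt_f_power[OF wt_top, of i]]
  by (simp_all only: v_vec_def smult_toT vsp_sel wt_def)

lemma v_vec_f: "toU q gF \<odot>\<^bsub>TM\<^esub> v_vec q n \<epsilon> i = v_vec q n \<epsilon> (i + 1)"
  by (simp add: v_vec_def smult_toT mult.assoc)

lemma v_vec_e: "toU q gE \<odot>\<^bsub>TM\<^esub> v_vec q n \<epsilon> i
    = (\<epsilon> * qint q (int i) * qint q (int n - int i + 1)) \<odot>\<^bsub>vsp q TM\<^esub>
      (if i = 0 then \<zero>\<^bsub>TM\<^esub> else v_vec q n \<epsilon> (i - 1))"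
  using v_e[of i] by (simp add: v_vec_def smult_toT zero_toT)

lemma z_vec_t: "toU q gT \<odot>\<^bsub>TM\<^esub> z_vec q n \<epsilon> (n + 1 + j)
    = (\<epsilon> * q powi (int n - 2 * int (n + 1 + j))) \<odot>\<^bsub>vsp q TM\<^esub> z_vec q n \<epsilon> (n + 1 + j)"
  and z_vec_tinv: "toU q gTinv \<odot>\<^bsub>TM\<^esub> z_vec q n \<epsilon> (n + 1 + j)
    = (\<epsilon> * q powi (- (int n - 2 * int (n + 1 + j)))) \<odot>\<^bsub>vsp q TM\<^esub> z_vec q n \<epsilon> (n + 1 + j)"
proof -
  have *: "int n - 2 * int (n + 1 + j) = - int n - 2 - 2 * int j" by simp
  show "toU q gT \<odot>\<^bsub>TM\<^esub> z_vec q n \<epsilon> (n + 1 + j)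
      = (\<epsilon> * q powi (int n - 2 * int (n + 1 + j))) \<odot>\<^bsub>vsp q TM\<^esub> z_vec q n \<epsilon> (n + 1 + j)"
    "toU q gTinv \<odot>\<^bsub>TM\<^esub> z_vec q n \<epsilon> (n + 1 + j)
      = (\<epsilon> * q powi (- (int n - 2 * int (n + 1 + j)))) \<odot>\<^bsub>vsp q TM\<^esub> z_vec q n \<epsilon> (n + 1 + j)"
    unfolding * using wt_f_power[OF wt_z, of j] wt_tinv[OF wt_f_power[OF wt_z, of j]]
    by (simp_all only: z_vec_eq smult_toT vsp_sel wt_def)
qed

lemma z_vec_f: "toU q gF \<odot>\<^bsub>TM\<^esub> z_vec q n \<epsilon> (n + 1 + j) = z_vec q n \<epsilon> (n + 1 + Suc j)"
  unfolding z_vec_eq by (simp add: smult_toT mult.assoc)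

lemma z_vec_e: "toU q gE \<odot>\<^bsub>TM\<^esub> z_vec q n \<epsilon> (n + 1 + j)
    = (\<epsilon> * qint q (int (n + 1 + j)) * qint q (int n - int (n + 1 + j) + 1))
        \<odot>\<^bsub>vsp q TM\<^esub> z_vec q n \<epsilon> (n + j) \<oplus>\<^bsub>TM\<^esub> v_vec q n \<epsilon> (n + j)"
proof -
  have *: "int (n + 1 + j) = int n + 1 + int j" "int n - (int n + 1 + int j) + 1 = - int j"
    by simp_all
  show ?thesis
  proof (cases j)
    \<comment> \<open>Here \<open>z_n\<close> is zero by definition, and the coefficient in
      \<open>z_f_e\<close> has the factor \<open>[0]\<close>.\<close>
    case 0
    then show ?thesis
      unfolding z_vec_eq using z_f_e[of 0]
      by (simp add: z_vec_def v_vec_def zero_toT smult_toT add_toT)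
  next
    case (Suc k)
    then have "z_vec q n \<epsilon> (n + j) = \<tau> (gF ^ (j - 1) * z_elt q n \<epsilon>)"
      using z_vec_eq[of k] by simp
    then show ?thesis
      unfolding * using z_f_e[of j] by (simp only: z_vec_eq v_vec_def vsp_sel smult_toT add_toT)
  qed
qed

section \<open>Spans as submodules, and generation by \<open>z\<close>\<close>

lemma range_fam: "range fam \<subseteq> carrier TM" "range (v_vec q n \<epsilon>) \<subseteq> carrier TM"
  using v_vec_carrier z_vec_carrier by (auto split: sum.split)

lemma span_closed:
  assumes "S \<subseteq> carrier TM"
  shows "x \<in> S \<Longrightarrow> x \<in> TV.span S"
    and "x \<in> TV.span S \<Longrightarrow> c \<odot>\<^bsub>vsp q TM\<^esub> x \<in> TV.span S"
    and "x \<in> TV.span S \<Longrightarrow> y \<in> TV.span S \<Longrightarrow> x \<oplus>\<^bsub>TM\<^esub> y \<in> TV.span S"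
    and "\<zero>\<^bsub>TM\<^esub> \<in> TV.span S"
proof -
  have sub: "LinearCombinations.submodule class_ring (TV.span S) (vsp q TM)"
    using assms by (intro TV.span_is_submodule) simp
  note closed = LinearCombinations.submodule.smult_closed[OF sub]
    LinearCombinations.submodule.m_closed[OF sub] LinearCombinations.submodule.zero_closed[OF sub]
  show "x \<in> S \<Longrightarrow> x \<in> TV.span S"
    using TV.in_own_span[of S] assms by auto
  show "x \<in> TV.span S \<Longrightarrow> c \<odot>\<^bsub>vsp q TM\<^esub> x \<in> TV.span S"
    by (rule closed(1)) (simp_all add: class_ring_simps)
  show "x \<in> TV.span S \<Longrightarrow> y \<in> TV.span S \<Longrightarrow> x \<oplus>\<^bsub>TM\<^esub> y \<in> TV.span S"
    using closed(2) by simp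
  show "\<zero>\<^bsub>TM\<^esub> \<in> TV.span S"
    using closed(3) by simp
qed

text \<open>The set \<open>S\<close> is left general so that the result serves both for the Verma
  submodule and for the span of the whole family.\<close>

lemma v_gens_span:
  assumes S: "S \<subseteq> carrier TM" "range (v_vec q n \<epsilon>) \<subseteq> S"
    and a: "a \<in> {gE, gF, gT, gTinv}"
  shows "toU q a \<odot>\<^bsub>TM\<^esub> v_vec q n \<epsilon> i \<in> TV.span S"
proof -
  have v: "v_vec q n \<epsilon> i \<in> TV.span S" for i
    using S by (intro span_closed(1)) auto
  have "toU q gE \<odot>\<^bsub>TM\<^esub> v_vec q n \<epsilon> i \<in> TV.span S"
    unfolding v_vec_e by (rule span_closed(2)[OF S(1)]) (use v span_closed(4)[OF S(1)] in auto)
  moreover have "toU q gF \<odot>\<^bsub>TM\<^esub> v_vec q n \<epsilon> i \<in> TV.span S"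
    unfolding v_vec_f by (rule v)
  moreover have "toU q gT \<odot>\<^bsub>TM\<^esub> v_vec q n \<epsilon> i \<in> TV.span S"
    unfolding v_vec_t by (intro span_closed(2) S v)
  moreover have "toU q gTinv \<odot>\<^bsub>TM\<^esub> v_vec q n \<epsilon> i \<in> TV.span S"
    unfolding v_vec_tinv by (intro span_closed(2) S v)
  ultimately show ?thesis using a by auto
qed

lemma z_gens_span:
  assumes a: "a \<in> {gE, gF, gT, gTinv}"
  shows "toU q a \<odot>\<^bsub>TM\<^esub> z_vec q n \<epsilon> (n + 1 + j) \<in> TV.span (range fam)"
proof -
  note S = range_fam(1)
  have v: "v_vec q n \<epsilon> i \<in> TV.span (range fam)" for i
    by (rule span_closed(1)[OF S]) (auto intro: range_eqI[of _ _ "Inl i"])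
  have z: "z_vec q n \<epsilon> (n + 1 + i) \<in> TV.span (range fam)" for i
    by (rule span_closed(1)[OF S]) (auto intro: range_eqI[of _ _ "Inr i"])
  have z': "z_vec q n \<epsilon> (n + i) \<in> TV.span (range fam)" for i
    using span_closed(4)[OF S] z[of "i - 1"] by (cases i) (simp_all add: z_vec_def)
  have "toU q gE \<odot>\<^bsub>TM\<^esub> z_vec q n \<epsilon> (n + 1 + j) \<in> TV.span (range fam)"
    unfolding z_vec_e by (intro span_closed(2,3) S v z')
  moreover have "toU q gF \<odot>\<^bsub>TM\<^esub> z_vec q n \<epsilon> (n + 1 + j) \<in> TV.span (range fam)"
    unfolding z_vec_f by (rule z)
  moreover have "toU q gT \<odot>\<^bsub>TM\<^esub> z_vec q n \<epsilon> (n + 1 + j) \<in> TV.span (range fam)"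
    unfolding z_vec_t by (intro span_closed(2) S z)
  moreover have "toU q gTinv \<odot>\<^bsub>TM\<^esub> z_vec q n \<epsilon> (n + 1 + j) \<in> TV.span (range fam)"
    unfolding z_vec_tinv by (intro span_closed(2) S z)
  ultimately show ?thesis using a by auto
qed

lemma submodule_span_v: "Module.submodule (TV.span (range (v_vec q n \<epsilon>))) (Uq q) TM"
  by (rule submodule_span[OF left_module_T_mod range_fam(2)])
    (use v_gens_span[OF range_fam(2) subset_refl] in blast)

lemma submodule_span_fam: "Module.submodule (TV.span (range fam)) (Uq q) TM"
proof (rule submodule_span[OF left_module_T_mod range_fam(1)])
  fix a :: "'k free_alg" and x assume a: "a \<in> {gE, gF, gT, gTinv}" and "x \<in> range fam"
  then obtain s where x: "x = fam s" by blast
  have "range (v_vec q n \<epsilon>) \<subseteq> range fam"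
    by (auto intro: range_eqI[of _ _ "Inl _"])
  then show "toU q a \<odot>\<^bsub>TM\<^esub> x \<in> TV.span (range fam)"
    unfolding x using v_gens_span[OF range_fam(1) _ a] z_gens_span[OF a] by (cases s) auto
qed

text \<open>From \<open>z\<close> one reaches \<open>e z = v_n\<close> and
  \<open>f v_n = v_{n+1}\<close>, and by \<open>one_toT\<close> the image of 1. This gives both the
  generation statement and, applied to \<open>submodule_span_fam\<close>, the spanning
  statement.\<close>

lemma submodule_eq_carrier:
  assumes N: "Module.submodule N (Uq q) TM" and z: "\<tau> (z_elt q n \<epsilon>) \<in> N"
  shows "N = carrier TM"
proof -
  have N_smult: "\<tau> (a * x) \<in> N" if "\<tau> x \<in> N" for a x
    using Module.submodule.smult_closed[OF N toU_carrier that, of a] by (simp add: smult_toT)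
  have N_add: "\<tau> (x + y) \<in> N" if "\<tau> x \<in> N" "\<tau> y \<in> N" for x y
    using subgroup.m_closed[OF Module.submodule.axioms(1)[OF N] that] by (simp add: add_toT)
  have "\<tau> (gF ^ n * gE ^ (n + 1)) \<in> N"
    using N_smult[OF z, of gE] by (simp only: z_e)
  then have "\<tau> (gF * (gF ^ n * gE ^ (n + 1))) \<in> N"
    by (rule N_smult)
  then have "\<tau> (gF ^ (n + 1) * gE ^ (n + 1)) \<in> N"
    by (simp add: mult.assoc)
  moreover obtain a b where "\<tau> 1 = \<tau> (scal a * z_elt q n \<epsilon> + scal b * (gF ^ (n + 1) * gE ^ (n + 1)))"
    using one_toT by blast
  ultimately have "\<tau> 1 \<in> N"
    using z by (auto intro: N_add N_smult)
  then have "\<tau> x \<in> N" for x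
    using N_smult[of 1 x] by simp
  then show ?thesis
    using subgroup.subset[OF Module.submodule.axioms(1)[OF N]] by (auto simp: carrier_T_mod)
qed

lemma span_fam: "TV.span (range fam) = carrier TM"
proof (rule submodule_eq_carrier[OF submodule_span_fam])
  have "\<tau> (z_elt q n \<epsilon>) = fam (Inr 0)"
    using z_vec_eq[of 0] by simp
  then show "\<tau> (z_elt q n \<epsilon>) \<in> TV.span (range fam)"
    using span_closed(1)[OF range_fam(1) rangeI, of "Inr 0"] by simp
qed

lemma submodule_carrier: "Module.submodule (carrier TM) (Uq q) TM"
  by (intro Module.submodule.intro submodule_axioms.intro TM.M.add.subgroup_self TM.smult_closed)

lemma gen_submodule_z: "gen_submodule (Uq q) TM {\<tau> (z_elt q n \<epsilon>)} = carrier TM"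
proof -
  \<comment> \<open>The intersection defining \<open>gen_submodule\<close> thus runs over a single
    set.\<close>
  have "Module.submodule N (Uq q) TM \<and> {\<tau> (z_elt q n \<epsilon>)} \<subseteq> N \<longleftrightarrow> N = carrier TM" for N
    using submodule_eq_carrier[of N] submodule_carrier toT_carrier[of q n \<epsilon> "z_elt q n \<epsilon>"] by blast
  then show ?thesis
    unfolding gen_submodule_def by (simp only: singleton_conv cInf_singleton)
qed

section \<open>Linear independence\<close>

definition to_model :: "'k free_alg set set \<Rightarrow> nat + nat \<Rightarrow> 'k" where
  "to_model X = model.act (SOME p. \<tau> p = X) (\<delta> (Inr 0))"

text \<open>The choice of representative does not matter, by \<open>act_eq_of_toT_eq\<close>;
  \<open>to_model\<close> is the map that sends \<open>w\<close> to \<open>z_{n+1}\<close>.\<close>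

lemma to_model_toT: "to_model (\<tau> p) = model.act p (\<delta> (Inr 0))"
  unfolding to_model_def by (rule act_eq_of_toT_eq, rule someI) (rule refl)

lemma to_model_add:
  assumes "X \<in> carrier TM" "Y \<in> carrier TM"
  shows "to_model (X \<oplus>\<^bsub>TM\<^esub> Y) = (\<lambda>s. to_model X s + to_model Y s)"
  using assms by (auto simp: carrier_T_mod add_toT to_model_toT model.act_add_left fun_eq_iff)

lemma to_model_smult:
  assumes "X \<in> carrier TM"
  shows "to_model (c \<odot>\<^bsub>vsp q TM\<^esub> X) = (\<lambda>s. c * to_model X s)"
  using assms by (auto simp: carrier_T_mod smult_toT to_model_toT model.act_mult)

lemma family_basis_fam: "family_basis class_ring (vsp q TM) UNIV fam"
proof (rule family_basisI[where \<Phi> = to_model])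
  fix A and c :: "nat + nat \<Rightarrow> 'k" and i
  assume A: "finite A" and sum: "\<And>s. (\<Sum>i\<in>A. c i * to_model (fam i) s) = 0" and i: "i \<in> A"
  obtain r where r: "r \<noteq> 0"
    "\<And>i. model.act (gF ^ i * gE ^ (n + 1)) (\<delta> (Inr 0)) = (\<lambda>s. r * \<delta> (Inl i) s)"
    using act_v by blast
  have r': "to_model (v_vec q n \<epsilon> i) = (\<lambda>s. r * \<delta> (Inl i) s)" for i
    unfolding v_vec_def to_model_toT by (rule r(2))
  obtain a b where ab: "a \<noteq> 0" "\<And>j. model.act (gF ^ j * z_elt q n \<epsilon>) (\<delta> (Inr 0)) =
      (\<lambda>s. a * \<delta> (Inr j) s + b * \<delta> (Inl (n + 1 + j)) s)"
    using act_z by blast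
  have ab': "to_model (z_vec q n \<epsilon> (n + 1 + j)) = (\<lambda>s. a * \<delta> (Inr j) s + b * \<delta> (Inl (n + 1 + j)) s)" for j
    unfolding z_vec_eq to_model_toT by (rule ab(2))
  \<comment> \<open>The images are triangular: the coordinate \<open>Inr j\<close> is nonzero only
    on the image of \<open>z_{n+1+j}\<close>. Once the \<open>z\<close> coefficients vanish, the
    coordinate \<open>Inl k\<close> isolates the coefficient of \<open>v_k\<close>.\<close>
  have z: "c (Inr j) = 0" if j: "Inr j \<in> A" for j
  proof -
    have "(\<Sum>i\<in>A. c i * to_model (fam i) (Inr j)) = (\<Sum>i\<in>A. if i = Inr j then c i * a else 0)"
    proof (rule sum.cong)
      fix i show "c i * to_model (fam i) (Inr j) = (if i = Inr j then c i * a else 0)"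
        by (cases i) (simp_all only: sum.case r' ab', simp_all)
    qed simp
    then show ?thesis using sum[of "Inr j"] A j ab(1) by simp
  qed
  show "c i = 0"
  proof (cases i)
    case (Inl k)
    have "(\<Sum>i\<in>A. c i * to_model (fam i) (Inl k)) = (\<Sum>i\<in>A. if i = Inl k then c i * r else 0)"
    proof (rule sum.cong)
      fix i assume "i \<in> A" then show "c i * to_model (fam i) (Inl k) = (if i = Inl k then c i * r else 0)"
        using z by (cases i) (simp_all only: sum.case r', simp_all)
    qed simp
    then show ?thesis using sum[of "Inl k"] A i r(1) Inl by simp
  next
    case (Inr j)
    then show ?thesis using z i by simp
  qed
qed (use range_fam span_fam to_model_add to_model_smult in \<open>auto intro: TV.vectorspace_axioms\<close>)

section \<open>The Verma submodule\<close>

lemma family_basis_v: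
  defines "N \<equiv> TV.span (range (v_vec q n \<epsilon>))"
  shows "family_basis class_ring (vsp q (TM\<lparr>carrier := N\<rparr>)) UNIV (v_vec q n \<epsilon>)"
proof -
  let ?v = "v_vec q n \<epsilon>"
  have sub: "LinearCombinations.submodule class_ring N (vsp q TM)"
    unfolding N_def using range_fam(2) by (intro TV.span_is_submodule) simp
  have vN: "range ?v \<subseteq> N"
    unfolding N_def using TV.in_own_span[of "range ?v"] range_fam(2) by simp
  have eq: "vsp q (TM\<lparr>carrier := N\<rparr>) = (vsp q TM)\<lparr>carrier := N\<rparr>"
    by (simp add: vsp_def)
  have V: "vectorspace class_ring ((vsp q TM)\<lparr>carrier := N\<rparr>)"
    by (intro vectorspace.intro TV.submodule_is_module[OF sub] class_field)
  have fam: "TV.lin_indpt (range fam)" and inj: "inj fam"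
    using family_basis_fam unfolding family_basis_def TV.basis_def by blast+
  \<comment> \<open>Independence is inherited from the full family;
    \<open>span_li_not_depend\<close> then carries independence and span over to the subspace
    \<open>N\<close>.\<close>
  have indpt: "TV.lin_indpt (range ?v)"
    by (rule TV.subset_li_is_li[OF fam]) (auto intro: range_eqI[of _ _ "Inl _"])
  have "inj ?v"
    using injD[OF inj, of "Inl _" "Inl _"] by (auto intro!: injI)
  then show ?thesis
    unfolding eq family_basis_def vectorspace.basis_def[OF V]
    using V vN indpt TV.span_li_not_depend[OF vN sub] by (simp add: N_def)
qed

text \<open>For \<open>l = \<epsilon> q^n\<close> the inverse is \<open>\<epsilon> q^(- n)\<close>,
  which turns the standard Verma coefficients into those of \<open>v_vec_t\<close> and
  \<open>v_vec_e\<close>.\<close>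

lemma is_verma_span_v:
  "is_verma q (TM\<lparr>carrier := TV.span (range (v_vec q n \<epsilon>))\<rparr>) (\<epsilon> * q ^ n) (v_vec q n \<epsilon>)"
proof -
  have t: "q powi (- 2 * int i) * (\<epsilon> * q ^ n) = \<epsilon> * q powi (int n - 2 * int i)" for i
    using q_nz by (simp add: power_int_diff power_int_minus divide_inverse mult_ac)
  have e: "(q powi (1 - int i) * (\<epsilon> * q ^ n) - q powi (int i - 1) * inverse (\<epsilon> * q ^ n)) / (q - inverse q)
      = \<epsilon> * qint q (int n - int i + 1)" for i
  proof -
    have *: "int n - int i + 1 = 1 - int i + int n" "- (1 - int i + int n) = int i - 1 - int n" by simp_all
    show ?thesis
      unfolding qint_def * power_int_diff[OF disjI1[OF q_nz], of "int i - 1"]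
        power_int_add[OF disjI1[OF q_nz], of "1 - int i"]
      by (simp add: divide_inverse right_diff_distrib mult_ac)
  qed
  show ?thesis
    unfolding is_verma_def t e
    using left_module_submodule[OF left_module_T_mod submodule_span_v] family_basis_v q_nz v_vec_t v_vec_f v_vec_e
    by (simp add: mult_ac)
qed

end

theorem theorem1:
  fixes q \<epsilon> :: "'k::field" and n :: nat
  assumes "CHAR('k) \<noteq> 2" and "CHAR('k) \<noteq> 3"
    and "q \<noteq> 0" and "\<forall>m>0. q ^ m \<noteq> 1"
    and "\<epsilon> = 1 \<or> \<epsilon> = -1"
  shows
    "gen_submodule (Uq q) (T_mod q n \<epsilon>) {toT q n \<epsilon> (z_elt q n \<epsilon>)} = carrier (T_mod q n \<epsilon>)
   \<and> family_basis class_ring (vsp q (T_mod q n \<epsilon>)) UNIV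
       (case_sum (v_vec q n \<epsilon>) (\<lambda>i. z_vec q n \<epsilon> (n + 1 + i)))
   \<and> (\<forall>i\<ge>n + 1.
        toU q gT \<odot>\<^bsub>T_mod q n \<epsilon>\<^esub> z_vec q n \<epsilon> i
          = (\<epsilon> * q powi (int n - 2 * int i)) \<odot>\<^bsub>vsp q (T_mod q n \<epsilon>)\<^esub> z_vec q n \<epsilon> i
      \<and> toU q gF \<odot>\<^bsub>T_mod q n \<epsilon>\<^esub> z_vec q n \<epsilon> i = z_vec q n \<epsilon> (i + 1)
      \<and> toU q gE \<odot>\<^bsub>T_mod q n \<epsilon>\<^esub> z_vec q n \<epsilon> i
          = (\<epsilon> * qint q (int i) * qint q (int n - int i + 1))
              \<odot>\<^bsub>vsp q (T_mod q n \<epsilon>)\<^esub> z_vec q n \<epsilon> (i - 1)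
            \<oplus>\<^bsub>T_mod q n \<epsilon>\<^esub> v_vec q n \<epsilon> (i - 1))
   \<and> (\<exists>N. Module.submodule N (Uq q) (T_mod q n \<epsilon>)
        \<and> is_verma q ((T_mod q n \<epsilon>)\<lparr>carrier := N\<rparr>) (\<epsilon> * q ^ n) (v_vec q n \<epsilon>))
   \<and> (\<forall>i.
        toU q gT \<odot>\<^bsub>T_mod q n \<epsilon>\<^esub> v_vec q n \<epsilon> i
          = (\<epsilon> * q powi (int n - 2 * int i)) \<odot>\<^bsub>vsp q (T_mod q n \<epsilon>)\<^esub> v_vec q n \<epsilon> i
      \<and> toU q gF \<odot>\<^bsub>T_mod q n \<epsilon>\<^esub> v_vec q n \<epsilon> i = v_vec q n \<epsilon> (i + 1)
      \<and> toU q gE \<odot>\<^bsub>T_mod q n \<epsilon>\<^esub> v_vec q n \<epsilon> i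
          = (\<epsilon> * qint q (int i) * qint q (int n - int i + 1))
              \<odot>\<^bsub>vsp q (T_mod q n \<epsilon>)\<^esub>
                (if i = 0 then \<zero>\<^bsub>T_mod q n \<epsilon>\<^esub> else v_vec q n \<epsilon> (i - 1)))"
proof -
  interpret T_parameters q \<epsilon> n
    using assms by unfold_locales auto
  have "toU q gT \<odot>\<^bsub>TM\<^esub> z_vec q n \<epsilon> i = (\<epsilon> * q powi (int n - 2 * int i)) \<odot>\<^bsub>vsp q TM\<^esub> z_vec q n \<epsilon> i
      \<and> toU q gF \<odot>\<^bsub>TM\<^esub> z_vec q n \<epsilon> i = z_vec q n \<epsilon> (i + 1)
      \<and> toU q gE \<odot>\<^bsub>TM\<^esub> z_vec q n \<epsilon> i
          = (\<epsilon> * qint q (int i) * qint q (int n - int i + 1)) \<odot>\<^bsub>vsp q TM\<^esub> z_vec q n \<epsilon> (i - 1)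
            \<oplus>\<^bsub>TM\<^esub> v_vec q n \<epsilon> (i - 1)" if "i \<ge> n + 1" for i
  proof -
    \<comment> \<open>Writing \<open>i = n + 1 + j\<close> makes every truncated subtraction exact:
      \<open>i - 1\<close> becomes \<open>n + j\<close>.\<close>
    define j where "j = i - (n + 1)"
    have *: "i = n + 1 + j" "n + 1 + j - 1 = n + j" "n + 1 + j + 1 = n + 1 + Suc j"
      using that by (simp_all add: j_def)
    show ?thesis
      unfolding * using z_vec_t z_vec_f z_vec_e by blast
  qed
  moreover have "\<exists>N. Module.submodule N (Uq q) TM \<and> is_verma q (TM\<lparr>carrier := N\<rparr>) (\<epsilon> * q ^ n) (v_vec q n \<epsilon>)"
    using submodule_span_v is_verma_span_v by blast
  ultimately show ?thesis
    using gen_submodule_z family_basis_fam v_vec_t v_vec_f v_vec_e by blast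
qed

end
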